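(* Let $M\ge 2$ be an integer and let $(a_k)_{k\ge1}$ be an admissible sequence of parameters in $(0,\frac1{2M})$, with $\underline a=\inf_{k\ge1}a_k$ and $\overline a=\sup_{k\ge1}a_k$. Let $\theta\in(0,1]$ and $L\ge0$, and let $\mu_1,\mu_2$ be Borel probability measures on $X=[0,1]^2$, absolutely continuous with respect to Lebesgue measure $m$, with $|d\mu_i/dm|_\theta\le L$ for $i=1,2$. Then for every $n\ge1$, $$\bigl|(T_{1,n})_*\mu_1-(T_{1,n})_*\mu_2\bigr|\le C_L e^{-C'n}.$$ Here $C'>0$ depends only on $\theta,M,\overline a,\underline a$, and $C_L$ depends in addition only on $L$.
   Context: Heterochaos baker map. Let $X=[0,1]^2$ with coordinates $(x_u,x_c)$ and let $m$ be the Lebesgue measure on $X$. For $a\in(0,\frac1M)$ define $\tau_a\colon[0,1]\to[0,1]$ by $\tau_a(x_u)=\frac{x_u-(i-1)a}{a}$ on $[(i-1)a,ia)$, $i=1,\dots,M$, and $\tau_a(x_u)=\frac{x_u-Ma}{1-Ma}$ on $[Ma,1]$. Put $\Omega_a(\alpha_i)=[(i-1)a,ia)\times[0,1]$ for $i=1,\dots,M$, $\Omega_a(\beta_i)=[Ma,1]\times[\frac{i-1}M,\frac iM)$ for $i=1,\dots,M-1$, and $\Omega_a(\beta_M)=[Ma,1]\times[\frac{M-1}M,1]$. Define $f_a\colon X\to X$ by $f_a(x_u,x_c)=(\tau_a(x_u),\frac{x_c}M+\frac{i-1}M)$ on $\Omega_a(\alpha_i)$ and $f_a(x_u,x_c)=(\tau_a(x_u),Mx_c-i+1)$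 on $\Omega_a(\beta_i)$, $i=1,\dots,M$. Write $T_k=f_{a_k}$ and $T_{k,\ell}=T_\ell\circ\cdots\circ T_k$ for $k\le\ell$. Admissibility: $(a_k)_{k\ge1}$ is admissible if $\max\{0,\frac{4M\overline a-1}{4M^2\overline a}\}<\underline a\le\overline a<\frac1{2M}$. For $g\colon X\to\mathbb R$, $|g|_\theta=\sup_{x\ne x'}\frac{|g(x)-g(x')|}{|x-x'|^\theta}$ (Euclidean distance). For a signed measure, $|\cdot|$ denotes its total variation; $(T)_*\mu$ is the pushforward of $\mu$ under $T$. *)

theory Defs
  imports "HOL-Probability.Probability"
begin

section \<open>The phase space\<close>

definition X :: "(real \<times> real) set" where
  "X = {0..1} \<times> {0..1}"

definition leb_X :: "(real \<times> real) measure" where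
  "leb_X = restrict_space lborel X"

section \<open>The heterochaos baker maps\<close>

text \<open>Points are pairs \<open>(x_u, x_c)\<close>. The pieces are numbered from \<open>1\<close> to \<open>M\<close>.
  Where an index is chosen by a definite description it is unique, as the lemmas
  \<open>tau_alpha\<close>, \<open>baker_alpha\<close> and \<open>baker_beta\<close> below confirm.\<close>

definition tau :: "nat \<Rightarrow> real \<Rightarrow> real \<Rightarrow> real" where
  "tau M a x =
    (if x < M * a
     then (let i = (THE i::nat. i \<in> {1..M} \<and> x \<in> {(real i - 1) * a ..< real i * a})
           in (x - (real i - 1) * a) / a)
     else (x - M * a) / (1 - M * a))"

definition Omega_alpha :: "nat \<Rightarrow> real \<Rightarrow> nat \<Rightarrow> (real \<times> real) set" where
  "Omega_alpha M a i = {(real i - 1) * a ..< real i * a} \<times> {0..1}"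

definition Omega_beta :: "nat \<Rightarrow> real \<Rightarrow> nat \<Rightarrow> (real \<times> real) set" where
  "Omega_beta M a i =
    {M * a .. 1} \<times> (if i < M then {(real i - 1) / M ..< real i / M} else {(real M - 1) / M .. 1})"

definition baker :: "nat \<Rightarrow> real \<Rightarrow> real \<times> real \<Rightarrow> real \<times> real" where
  "baker M a p =
    (if \<exists>i\<in>{1..M}. p \<in> Omega_alpha M a i
     then (let i = (THE i. i \<in> {1..M} \<and> p \<in> Omega_alpha M a i)
           in (tau M a (fst p), snd p / M + (real i - 1) / M))
     else (let i = (THE i. i \<in> {1..M} \<and> p \<in> Omega_beta M a i)
           in (tau M a (fst p), M * snd p - real i + 1)))"

text \<open>The composition \<open>T_l \<circ> \<dots> \<circ> T_k\<close>, where \<open>T_j = baker M (a j)\<close>: the map \<open>T_k\<close> acts first.\<close>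

definition baker_comp :: "nat \<Rightarrow> (nat \<Rightarrow> real) \<Rightarrow> nat \<Rightarrow> nat \<Rightarrow> real \<times> real \<Rightarrow> real \<times> real" where
  "baker_comp M a k l = fold (\<lambda>j. baker M (a j)) [k..<Suc l]"

section \<open>Admissible parameter sequences\<close>

text \<open>Sequences are indexed from \<open>1\<close>; the value at \<open>0\<close> is irrelevant.\<close>

definition a_inf :: "(nat \<Rightarrow> real) \<Rightarrow> real" where
  "a_inf a = (INF k\<in>{1..}. a k)"

definition a_sup :: "(nat \<Rightarrow> real) \<Rightarrow> real" where
  "a_sup a = (SUP k\<in>{1..}. a k)"

definition admissible :: "nat \<Rightarrow> (nat \<Rightarrow> real) \<Rightarrow> bool" where
  "admissible M a \<longleftrightarrow>
     max 0 ((4 * M * a_sup a - 1) / (4 * (real M)\<^sup>2 * a_sup a)) < a_inf a \<and>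
     a_inf a \<le> a_sup a \<and> a_sup a < 1 / (2 * M)"

section \<open>Hoelder seminorm and total variation\<close>

text \<open>The distance on \<^typ>\<open>real \<times> real\<close> is the Euclidean one. The seminorm may be infinite.\<close>

definition holder_seminorm :: "real \<Rightarrow> (real \<times> real \<Rightarrow> real) \<Rightarrow> ereal" where
  "holder_seminorm \<theta> g =
    (SUP (x, x') \<in> {(x, x'). x \<in> X \<and> x' \<in> X \<and> x \<noteq> x'}.
      ereal (\<bar>g x - g x'\<bar> / dist x x' powr \<theta>))"

text \<open>A signed measure is represented by its set function \<open>\<nu>\<close> on the measurable sets of \<open>N\<close>.
  The normalisation is that of the total mass of \<open>\<bar>\<nu>\<bar>\<close>, so two mutually singular probability
  measures differ by \<open>2\<close>.\<close>

definition total_variation :: "'a measure \<Rightarrow> ('a set \<Rightarrow> real) \<Rightarrow> ereal" where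
  "total_variation N \<nu> =
    (SUP P \<in> {P. finite P \<and> partition_on (space N) P \<and> P \<subseteq> sets N}.
      ereal (\<Sum>A\<in>P. \<bar>\<nu> A\<bar>))"

section \<open>The piecewise formulas and measurability\<close>

lemma tau_index_unique:
  fixes i j :: nat and a x :: real
  assumes "0 < a" "x \<in> {(real i - 1) * a ..< real i * a}" "x \<in> {(real j - 1) * a ..< real j * a}"
  shows "i = j"
proof -
  have "(real i - 1) * a < real j * a" "(real j - 1) * a < real i * a"
    using assms(2,3) unfolding atLeastLessThan_iff by linarith+
  then have "real i - 1 < real j" "real j - 1 < real i"
    using mult_less_cancel_right_pos[OF assms(1)] by blast+
  then show ?thesis by linarith
qed

lemma tau_alpha:
  fixes a x :: real and i M :: nat
  assumes "0 < a" "i \<in> {1..M}" "x \<in> {(real i - 1) * a ..< real i * a}"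
  shows "tau M a x = (x - (real i - 1) * a) / a"
proof -
  have "real i * a \<le> real M * a"
    using assms by (intro mult_right_mono) auto
  moreover have "x < real i * a" using assms by simp
  ultimately have "x < M * a" by linarith
  moreover have "(THE i::nat. i \<in> {1..M} \<and> x \<in> {(real i - 1) * a ..< real i * a}) = i"
    using assms tau_index_unique by (intro the_equality) blast+
  ultimately show ?thesis by (simp add: tau_def Let_def)
qed

lemma baker_alpha:
  fixes a x y :: real and i M :: nat
  assumes "0 < a" "i \<in> {1..M}" "(x, y) \<in> Omega_alpha M a i"
  shows "baker M a (x, y) = ((x - (real i - 1) * a) / a, y / M + (real i - 1) / M)"
proof -
  have "x \<in> {(real i - 1) * a ..< real i * a}"
    using assms by (auto simp: Omega_alpha_def)
  then have "tau M a x = (x - (real i - 1) * a) / a"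
    using tau_alpha assms by blast
  moreover have "(THE i. i \<in> {1..M} \<and> (x, y) \<in> Omega_alpha M a i) = i"
    using assms tau_index_unique[OF assms(1)]
    by (intro the_equality) (auto simp: Omega_alpha_def)
  ultimately show ?thesis
    using assms by (auto simp: baker_def Let_def)
qed

lemma Omega_beta_index_unique:
  assumes "i \<in> {1..M}" "j \<in> {1..M}" "p \<in> Omega_beta M a i" "p \<in> Omega_beta M a j"
  shows "i = j"
proof -
  have M: "real M > 0" using assms by auto
  have lo: "real k - 1 \<le> M * snd p" if "k \<in> {1..M}" "p \<in> Omega_beta M a k" for k
    using that M by (cases "k < M") (auto simp: Omega_beta_def field_simps)
  have hi: "M * snd p < real k" if "k < M" "p \<in> Omega_beta M a k" for k
    using that M by (auto simp: Omega_beta_def field_simps)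
  have "\<not> i < j" if "i \<in> {1..M}" "j \<in> {1..M}" "p \<in> Omega_beta M a i" "p \<in> Omega_beta M a j" for i j
    using lo[of j] hi[of i] that by auto
  from this[of i j] this[of j i] show ?thesis using assms by force
qed

lemma baker_beta:
  fixes a x y :: real and i M :: nat
  assumes "0 < a" "i \<in> {1..M}" "(x, y) \<in> Omega_beta M a i"
  shows "baker M a (x, y) = ((x - M * a) / (1 - M * a), M * y - real i + 1)"
proof -
  have x: "M * a \<le> x" using assms by (auto simp: Omega_beta_def)
  have "\<not> (\<exists>i\<in>{1..M}. (x, y) \<in> Omega_alpha M a i)"
  proof
    assume "\<exists>i\<in>{1..M}. (x, y) \<in> Omega_alpha M a i"
    then obtain j where "j \<in> {1..M}" "x < real j * a"
      by (auto simp: Omega_alpha_def)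
    moreover from this have "real j * a \<le> M * a"
      using assms(1) by (intro mult_right_mono) auto
    ultimately show False using x by linarith
  qed
  moreover have "(THE i. i \<in> {1..M} \<and> (x, y) \<in> Omega_beta M a i) = i"
    using assms Omega_beta_index_unique by (intro the_equality) blast+
  ultimately show ?thesis
    using x by (simp add: baker_def tau_def Let_def)
qed

lemma Omega_cover:
  fixes a :: real and M :: nat
  assumes "0 < a" "M \<ge> 1" "p \<in> X"
  shows "\<exists>i\<in>{1..M}. p \<in> Omega_alpha M a i \<or> p \<in> Omega_beta M a i"
proof -
  obtain x y where p: "p = (x, y)" "0 \<le> x" "x \<le> 1" "0 \<le> y" "y \<le> 1"
    using assms(3) by (auto simp: X_def)
  have M: "real M > 0" using assms by simp
  show ?thesis
  proof (cases "x < M * a")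
    case True
    define i where "i = nat \<lfloor>x / a\<rfloor> + 1"
    have fl: "real i - 1 \<le> x / a" "x / a < real i"
      using p assms(1) by (simp_all add: i_def) linarith
    have "x / a < M" using True assms(1) by (simp add: field_simps)
    then have "i \<in> {1..M}" using fl by (auto simp: i_def)
    moreover have "p \<in> Omega_alpha M a i"
      using fl p assms(1) by (auto simp: Omega_alpha_def field_simps)
    ultimately show ?thesis by blast
  next
    case False
    define i where "i = nat \<lfloor>M * y\<rfloor> + 1"
    have fl: "real i - 1 \<le> M * y" "M * y < real i"
      using p M by (simp_all add: i_def) linarith
    show ?thesis
    proof (cases "i < M")
      case True
      then have "p \<in> Omega_beta M a i"
        using fl p M False by (auto simp: Omega_beta_def field_simps)
      then show ?thesis using True by (auto simp: i_def)
    next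
      case F: False
      then have "real M - 1 \<le> M * y" using fl by linarith
      then have "p \<in> Omega_beta M a M"
        using p M False by (auto simp: Omega_beta_def field_simps)
      then show ?thesis using assms(2) by auto
    qed
  qed
qed

lemma baker_in_X:
  fixes a :: real and M :: nat
  assumes "0 < a" "M * a < 1" "M \<ge> 1" "p \<in> X"
  shows "baker M a p \<in> X"
proof -
  obtain x y where p: "p = (x, y)" "0 \<le> x" "x \<le> 1" "0 \<le> y" "y \<le> 1"
    using assms(4) by (auto simp: X_def)
  have M: "real M > 0" using assms by simp
  from Omega_cover[OF assms(1,3,4)] obtain i where i: "i \<in> {1..M}"
    and "p \<in> Omega_alpha M a i \<or> p \<in> Omega_beta M a i" by blast
  then show ?thesis
  proof (elim disjE)
    assume *: "p \<in> Omega_alpha M a i"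
    have "y + (real i - 1) \<le> M" using p i by auto
    then show ?thesis
      using * p baker_alpha[OF assms(1) i, of x y] assms(1) M i
      by (auto simp: X_def Omega_alpha_def field_simps)
  next
    assume *: "p \<in> Omega_beta M a i"
    have "real i - 1 \<le> M * y" "M * y \<le> real i"
      using * p i M by (auto simp: Omega_beta_def field_simps split: if_splits)
    then show ?thesis
      using * p baker_beta[OF assms(1) i, of x y] assms(2)
      by (auto simp: X_def Omega_beta_def field_simps)
  qed
qed

lemma X_borel: "X \<in> sets borel"
  unfolding X_def by (intro borel_closed closed_Times) auto

lemma space_leb_X: "space leb_X = X"
  by (simp add: leb_X_def space_restrict_space)

lemma prob_space_leb_X: "prob_space leb_X"
proof
  have "X = cbox (0, 0) (1, 1)" by (simp add: X_def cbox_Pair_eq)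
  moreover have "emeasure lborel (cbox (0::real, 0::real) (1, 1)) = 1"
    by (simp add: emeasure_lborel_cbox_eq Basis_prod_def)
  ultimately show "emeasure leb_X (space leb_X) = 1"
    using X_borel by (simp add: space_leb_X leb_X_def emeasure_restrict_space)
qed

lemma Omega_borel: "Omega_alpha M a i \<in> sets borel" "Omega_beta M a i \<in> sets borel"
  unfolding Omega_alpha_def Omega_beta_def borel_prod[symmetric]
  by (auto intro!: pair_measureI)

lemma measurable_baker:
  fixes a :: real and M :: nat
  assumes "0 < a" "M * a < 1" "M \<ge> 1"
  shows "baker M a \<in> leb_X \<rightarrow>\<^sub>M leb_X"
proof -
  define C where
    "C = (\<lambda>i. X \<inter> Omega_alpha M a i) ` {1..M} \<union> (\<lambda>i. X \<inter> Omega_beta M a i) ` {1..M}"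
  have "baker M a \<in> leb_X \<rightarrow>\<^sub>M borel"
  proof (rule measurable_piecewise_restrict[where C = C])
    show "countable C" by (simp add: C_def)
    show "\<And>\<Omega>. \<Omega> \<in> C \<Longrightarrow> \<Omega> \<inter> space leb_X \<in> sets leb_X"
      using X_borel Omega_borel
      by (auto simp: C_def space_leb_X leb_X_def sets_restrict_space_iff)
    show "space leb_X \<subseteq> \<Union>C"
      using Omega_cover[OF assms(1,3)] by (fastforce simp: C_def space_leb_X)
  next
    fix \<Omega> assume "\<Omega> \<in> C"
    then obtain i where i: "i \<in> {1..M}"
      and "\<Omega> = X \<inter> Omega_alpha M a i \<or> \<Omega> = X \<inter> Omega_beta M a i" by (auto simp: C_def)
    then obtain h :: "real \<times> real \<Rightarrow> real \<times> real"
      where h: "h \<in> borel_measurable borel" "\<And>p. p \<in> \<Omega> \<Longrightarrow> baker M a p = h p"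
    proof (elim disjE)
      assume "\<Omega> = X \<inter> Omega_alpha M a i"
      then show thesis
        using baker_alpha[OF assms(1) i] assms(1,3)
        by (intro that[of "\<lambda>p. ((fst p - (real i - 1) * a) / a, snd p / M + (real i - 1) / M)"])
          (auto intro!: borel_measurable_continuous_onI continuous_intros)
    next
      assume "\<Omega> = X \<inter> Omega_beta M a i"
      then show thesis
        using baker_beta[OF assms(1) i] assms(2)
        by (intro that[of "\<lambda>p. ((fst p - M * a) / (1 - M * a), M * snd p - real i + 1)"])
          (auto intro!: borel_measurable_continuous_onI continuous_intros)
    qed
    have "h \<in> restrict_space leb_X \<Omega> \<rightarrow>\<^sub>M borel"
      using h(1) unfolding leb_X_def by (intro measurable_restrict_space1) simp
    then show "baker M a \<in> restrict_space leb_X \<Omega> \<rightarrow>\<^sub>M borel"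
      by (subst measurable_cong[where g = h]) (auto simp: space_restrict_space h(2))
  qed
  moreover have "leb_X \<rightarrow>\<^sub>M leb_X = leb_X \<rightarrow>\<^sub>M restrict_space borel X"
    by (intro measurable_cong_sets) (auto simp: leb_X_def sets_restrict_space)
  ultimately show ?thesis
    using baker_in_X[OF assms] by (auto intro!: measurable_restrict_space2 simp: space_leb_X)
qed

end

theory Submission
  imports Defs
begin

text \<open>The transfer operator of a baker map averages a density over the inverse branches. In terms of
  the base-\<open>M\<close> expansion of \<open>x_c\<close>, the inverse \<open>\<alpha>\<close>-branches, of total weight \<open>p = M a < 1/2\<close>, delete
  the leading digit, and the inverse \<open>\<beta>\<close>-branches, each of weight \<open>(1 - p)/M\<close>, prepend a uniformly
  distributed digit; all of them contract \<open>x_u\<close>. The digits therefore form a stack that grows on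
  average. Two points sharing \<open>k\<close> leading digits are compared by the weight
  \<open>s^-k + \<eta> \<bar>u - u'\<bar>^\<theta>\<close>; for \<open>s > 1\<close> close to \<open>1\<close> and \<open>\<eta>\<close> small, one coupled step multiplies the
  expected weight by at most some \<open>\<rho> < 1\<close>. Hence the oscillation of the transferred density decays
  like \<open>\<rho>^n\<close>, and a density of integral \<open>1\<close> converges uniformly to the constant \<open>1\<close>.\<close>

section \<open>Digits and the transfer operator\<close>

text \<open>The baker maps send the half-open square into itself piecewise without boundary
  exceptions, and \<open>X - Q\<close> is a null set.\<close>

definition Q :: "(real \<times> real) set" where
  "Q = {0..<1} \<times> {0..<1}"

text \<open>Agreement of the first \<open>k\<close> base-\<open>M\<close> digits. The recursion runs
  along the digit shift, so that deleting a leading digit is a single unfolding.\<close>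

fun same_digits :: "nat \<Rightarrow> nat \<Rightarrow> real \<Rightarrow> real \<Rightarrow> bool" where
  "same_digits M 0 c c' \<longleftrightarrow> True"
| "same_digits M (Suc k) c c' \<longleftrightarrow>
     \<lfloor>M * c\<rfloor> = \<lfloor>M * c'\<rfloor> \<and> same_digits M k (frac (M * c)) (frac (M * c'))"

text \<open>Multiplying by \<open>M\<close> undoes the prepending: the floor is the new digit
  \<open>j\<close>, and the fractional part is the old point.\<close>

lemma same_digits_push:
  assumes "M \<ge> 1" "c \<in> {0..<1}" "c' \<in> {0..<1}" "same_digits M k c c'"
  shows "same_digits M (Suc k) ((c + real j) / M) ((c' + real j) / M)"
proof -
  have "real M * ((x + real j) / M) = x + real j" for x using assms(1) by simp
  moreover have "\<lfloor>x + real j\<rfloor> = int j" "frac (x + real j) = x" if "x \<in> {0..<1}" for x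
    using that by (auto simp: frac_def floor_eq_iff)
  ultimately show ?thesis using assms by simp
qed

text \<open>Equal leading digits cancel in the difference of the fractional parts, which is
  therefore \<open>M * (c - c')\<close>; every shared digit gains a factor
  \<open>1 / M\<close>.\<close>

lemma same_digits_dist:
  assumes "M \<ge> 1" "c \<in> {0..<1}" "c' \<in> {0..<1}" "same_digits M k c c'"
  shows "\<bar>c - c'\<bar> \<le> 1 / real M ^ k"
  using assms(2-)
proof (induction k arbitrary: c c')
  case (Suc k)
  have "\<bar>frac (M * c) - frac (M * c')\<bar> \<le> 1 / real M ^ k"
    using Suc by (intro Suc.IH) (auto simp: frac_lt_1)
  moreover have "frac (M * c) - frac (M * c') = M * (c - c')"
    using Suc.prems by (simp add: frac_def algebra_simps)
  ultimately have "real M * \<bar>c - c'\<bar> \<le> 1 / real M ^ k"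
    by (simp add: abs_mult)
  then show ?case
    using assms(1) by (simp add: field_simps)
qed auto

text \<open>The Perron-Frobenius operator of \<open>baker M a\<close> on \<open>Q\<close>: each
  inverse branch carries its Jacobian. The \<alpha>-images are disjoint strips, one for each leading
  digit of \<open>c\<close>, which leaves one \<alpha>-preimage; every \<beta>-image is all of
  \<open>Q\<close>, which gives \<open>M\<close> \<beta>-preimages.\<close>

definition transfer :: "nat \<Rightarrow> real \<Rightarrow> (real \<times> real \<Rightarrow> real) \<Rightarrow> real \<times> real \<Rightarrow> real" where
  "transfer M a h = (\<lambda>(u, c).
     M * a * h (a * (u + real_of_int \<lfloor>real M * c\<rfloor>), frac (real M * c)) +
     (1 - M * a) / M * (\<Sum>j<M. h ((1 - M * a) * u + M * a, (c + real j) / M)))"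

text \<open>Quantifying over every shared length \<open>k\<close> avoids naming the maximal one,
  which is infinite for \<open>c = c'\<close>.\<close>

definition digit_holder ::
  "nat \<Rightarrow> real \<Rightarrow> real \<Rightarrow> real \<Rightarrow> real \<Rightarrow> (real \<times> real \<Rightarrow> real) \<Rightarrow> bool" where
  "digit_holder M s \<eta> \<theta> K h \<longleftrightarrow> (\<forall>k u u' c c'. (u, c) \<in> Q \<longrightarrow> (u', c') \<in> Q \<longrightarrow> same_digits M k c c' \<longrightarrow>
     \<bar>h (u, c) - h (u', c')\<bar> \<le> K * (1 / s ^ k + \<eta> * \<bar>u - u'\<bar> powr \<theta>))"

section \<open>Contraction under one transfer step\<close>

lemma pop_in_Q:
  fixes M :: nat and a u c :: real
  assumes "0 < a" "M * a < 1" "M \<ge> 1" "(u, c) \<in> Q"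
  shows "(a * (u + real_of_int \<lfloor>real M * c\<rfloor>), frac (real M * c)) \<in> Q"
proof -
  have "M * c < M" "0 \<le> M * c" using assms(3,4) by (auto simp: Q_def)
  then have "\<lfloor>M * c\<rfloor> < int M" "0 \<le> \<lfloor>M * c\<rfloor>" by (auto simp: floor_less_iff)
  then have "real_of_int \<lfloor>M * c\<rfloor> + 1 \<le> M" "0 \<le> real_of_int \<lfloor>M * c\<rfloor>" by linarith+
  moreover have "u < 1" "0 \<le> u" using assms(4) by (auto simp: Q_def)
  ultimately have "a * (u + \<lfloor>M * c\<rfloor>) < a * M" "0 \<le> a * (u + \<lfloor>M * c\<rfloor>)"
    using assms(1) by auto
  then show ?thesis using assms(2) by (auto simp: Q_def frac_lt_1 mult.commute)
qed

lemma push_in_Q: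
  fixes M j :: nat and a u c :: real
  assumes "0 < a" "M * a < 1" "j < M" "(u, c) \<in> Q"
  shows "((1 - M * a) * u + M * a, (c + real j) / M) \<in> Q"
proof -
  have u: "u < 1" "0 \<le> u" and c: "0 \<le> c" "c < 1" using assms(4) by (auto simp: Q_def)
  have "(1 - M * a) * u < (1 - M * a) * 1" "0 \<le> (1 - M * a) * u" "0 \<le> M * a"
    using assms(1) u assms(2) by (auto simp del: mult_1_right)
  moreover have "real j + 1 \<le> M" using assms(3) by linarith
  ultimately show ?thesis using c assms(3) by (auto simp: Q_def divide_less_eq)
qed

text \<open>The two \<alpha>-branches are coupled, and so are \<beta>-branches with the same digit.
  Popping a shared digit multiplies the digit weight by \<open>s\<close>, pushing divides it by
  \<open>s\<close>, and the mean factor is worst when popping has its maximal probability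
  \<open>q\<close>: this is the first lower bound on \<open>\<rho>\<close>. The second one controls
  the \<open>u\<close>-term whenever both points follow the same affine map.\<close>

lemma transfer_digit_holder:
  fixes M :: nat and a_low a q s \<eta> \<theta> \<rho> K :: real
  assumes M: "M \<ge> 2" and a: "0 < a_low" "a_low \<le> a" "M * a \<le> q" "q \<le> 1 / 2"
    and \<theta>: "0 < \<theta>" and s: "1 < s" and \<eta>: "0 \<le> \<eta>" "\<eta> \<le> q * (s - 1)" and K: "0 \<le> K"
    and \<rho>: "q * s + (1 - q) / s \<le> \<rho>" "(1 - M * a_low) powr \<theta> \<le> \<rho>"
    and h: "digit_holder M s \<eta> \<theta> K h"
  shows "digit_holder M s \<eta> \<theta> (\<rho> * K) (transfer M a h)"
  unfolding digit_holder_def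
proof (intro allI impI)
  fix k u u' c c'
  assume x: "(u, c) \<in> Q" "(u', c') \<in> Q" and k: "same_digits M k c c'"
  define p where "p = M * a"
  define t where "t = \<bar>u - u'\<bar> powr \<theta>"
  have a0: "0 < a" using a by linarith
  have p: "0 < p" "p \<le> q" "p < 1" using a M a0 by (auto simp: p_def)
  have p1: "M * a < 1" using p p_def by simp
  have t0: "0 \<le> t" by (simp add: t_def)
  have c01: "c \<in> {0..<1}" "c' \<in> {0..<1}" using x by (auto simp: Q_def)
  \<comment> \<open>Used with slope \<open>a\<close> for popping and \<open>1 - M * a\<close> for
    pushing; both are at most \<open>1 - M * a_low\<close>.\<close>
  have lip: "\<bar>b * u + e - (b * u' + e)\<bar> powr \<theta> \<le> \<rho> * t" if "0 \<le> b" "b \<le> 1 - M * a_low" for b e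
  proof -
    have "\<bar>b * u + e - (b * u' + e)\<bar> = b * \<bar>u - u'\<bar>"
      using that by (simp add: abs_mult flip: right_diff_distrib)
    then have "\<bar>b * u + e - (b * u' + e)\<bar> powr \<theta> = b powr \<theta> * t"
      using that by (simp add: t_def powr_mult)
    also have "b powr \<theta> \<le> \<rho>"
      using powr_mono2[of \<theta> b "1 - M * a_low"] that \<theta> \<rho>(2) by simp
    finally show ?thesis using t0 by (simp add: mult_right_mono)
  qed
  have Ma: "M * a_low \<le> M * a" using a M by simp
  \<comment> \<open>Prepending the same digit \<open>j\<close> to both points makes
    \<open>k + 1\<close> shared digits.\<close>
  have beta: "\<bar>h ((1 - M * a) * u + M * a, (c + real j) / M) - h ((1 - M * a) * u' + M * a, (c' + real j) / M)\<bar>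
      \<le> K * (1 / (s * s ^ k) + \<eta> * (\<rho> * t))" (is "?l \<le> _") if j: "j < M" for j
  proof -
    have "?l \<le> K * (1 / s ^ Suc k + \<eta> * \<bar>(1 - M * a) * u + M * a - ((1 - M * a) * u' + M * a)\<bar> powr \<theta>)"
      using h push_in_Q[OF a0 p1 j] x same_digits_push[OF _ c01 k] M
      unfolding digit_holder_def by (metis One_nat_def Suc_leD numeral_2_eq_2)
    also have "\<dots> \<le> K * (1 / s ^ Suc k + \<eta> * (\<rho> * t))"
      using lip[of "1 - M * a" "M * a"] p1 Ma K \<eta>(1)
      by (intro mult_left_mono add_left_mono) auto
    finally show ?thesis by simp
  qed
  define S where "S = 1 / s ^ k"
  define A where "A = h (a * (u + real_of_int \<lfloor>real M * c\<rfloor>), frac (real M * c)) - h (a * (u' + real_of_int \<lfloor>real M * c'\<rfloor>), frac (M * c'))"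
  define B where "B = (\<lambda>j. h ((1 - M * a) * u + M * a, (c + real j) / M) - h ((1 - M * a) * u' + M * a, (c' + real j) / M))"
  have S: "0 < S" using s by (simp add: S_def)
  have "\<bar>\<Sum>j<M. B j\<bar> \<le> (\<Sum>j<M. \<bar>B j\<bar>)" by (rule sum_abs)
  also have "\<dots> \<le> (\<Sum>j<M. K * (S / s + \<eta> * (\<rho> * t)))"
    using beta by (intro sum_mono) (auto simp: B_def S_def mult.commute)
  finally have "\<bar>\<Sum>j<M. B j\<bar> \<le> M * (K * (S / s + \<eta> * (\<rho> * t)))" by simp
  then have "(1 - p) / M * \<bar>\<Sum>j<M. B j\<bar> \<le> (1 - p) / M * (M * (K * (S / s + \<eta> * (\<rho> * t))))"
    using p by (intro mult_left_mono) auto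
  also have "\<dots> = (1 - p) * (K * (S / s + \<eta> * (\<rho> * t)))" using M by simp
  finally have Bb: "(1 - p) / M * \<bar>\<Sum>j<M. B j\<bar> \<le> (1 - p) * (K * (S / s + \<eta> * (\<rho> * t)))" .
  have eq: "transfer M a h (u, c) - transfer M a h (u', c') = p * A + (1 - p) / M * (\<Sum>j<M. B j)"
    by (simp add: transfer_def A_def B_def p_def sum_subtractf right_diff_distrib)
  \<comment> \<open>Since \<open>p \<le> q\<close>, shifting mass to the larger value
    \<open>x\<close> replaces the current probability by the uniform bound.\<close>
  have sq: "p * x + (1 - p) * y \<le> q * x + (1 - q) * y" if "y \<le> x" for x y
    using mult_right_mono[OF p(2), of "x - y"] that by (simp add: algebra_simps)
  have inv_s: "1 / s \<le> 1" using s by simp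
  have A: "p * \<bar>A\<bar> + (1 - p) * (K * (S / s + \<eta> * (\<rho> * t))) \<le> K * (\<rho> * S + \<eta> * (\<rho> * t))"
  proof (cases k)
    case 0
    \<comment> \<open>The deleted digits may differ, so the new \<open>x_u\<close>-coordinates can be far apart. The resulting
      loss \<open>p \<eta>\<close> is absorbed by the gain \<open>q (s - 1)\<close> from the digit weight, which cannot
      grow beyond \<open>s^0\<close>.\<close>
    have "\<bar>A\<bar> \<le> K * (1 / s ^ 0 + \<eta> * \<bar>a * (u + \<lfloor>M * c\<rfloor>) - a * (u' + \<lfloor>M * c'\<rfloor>)\<bar> powr \<theta>)"
      unfolding A_def
      using h pop_in_Q[OF a0 p1] x M unfolding digit_holder_def
      by (metis One_nat_def Suc_leD numeral_2_eq_2 same_digits.simps(1))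
    also have "\<dots> \<le> K * (1 + \<eta> * 1)"
    proof -
      have "\<bar>a * (u + \<lfloor>M * c\<rfloor>) - a * (u' + \<lfloor>M * c'\<rfloor>)\<bar> \<le> 1"
        using pop_in_Q[OF a0 p1 _ x(1)] pop_in_Q[OF a0 p1 _ x(2)] M by (auto simp: Q_def)
      then have "\<bar>a * (u + \<lfloor>M * c\<rfloor>) - a * (u' + \<lfloor>M * c'\<rfloor>)\<bar> powr \<theta> \<le> 1"
        using \<theta> by (intro powr_le1) auto
      then show ?thesis using K \<eta>(1) by (intro mult_left_mono add_mono) auto
    qed
    finally have "p * \<bar>A\<bar> \<le> p * (K * (1 + \<eta>))" using p by simp
    moreover have "p * (1 + \<eta>) + (1 - p) * (1 / s + \<eta> * (\<rho> * t)) \<le> \<rho> + \<eta> * (\<rho> * t)"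
    proof -
      have "p * \<eta> \<le> \<eta>" using p \<eta> by (simp add: mult_left_le_one_le)
      moreover have "p * 1 + (1 - p) * (1 / s) \<le> q * 1 + (1 - q) * (1 / s)"
        using sq[OF inv_s] by simp
      moreover have "0 \<le> \<eta> * (\<rho> * t)"
        using \<eta> t0 order_trans[OF powr_ge_zero \<rho>(2)] by simp
      then have "0 \<le> p * (\<eta> * (\<rho> * t))" using p by simp
      ultimately show ?thesis using \<rho>(1) \<eta>(2) by (simp add: algebra_simps)
    qed
    then have "K * (p * (1 + \<eta>) + (1 - p) * (1 / s + \<eta> * (\<rho> * t))) \<le> K * (\<rho> + \<eta> * (\<rho> * t))"
      using K by (rule mult_left_mono)
    ultimately show ?thesis using 0 by (simp add: S_def algebra_simps)
  next
    \<comment> \<open>The deleted digits agree: both points undergo the same affine map in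
      \<open>u\<close>, and \<open>k'\<close> shared digits remain.\<close>
    case (Suc k')
    then have fl: "\<lfloor>M * c\<rfloor> = \<lfloor>M * c'\<rfloor>" and k': "same_digits M k' (frac (M * c)) (frac (M * c'))"
      using k by auto
    have "\<bar>A\<bar> \<le> K * (1 / s ^ k' + \<eta> * \<bar>a * (u + \<lfloor>M * c\<rfloor>) - a * (u' + \<lfloor>M * c'\<rfloor>)\<bar> powr \<theta>)"
      unfolding A_def
      using h pop_in_Q[OF a0 p1] x M k' unfolding digit_holder_def
      by (metis One_nat_def Suc_leD numeral_2_eq_2)
    also have "\<dots> \<le> K * (S * s + \<eta> * (\<rho> * t))"
    proof -
      \<comment> \<open>As \<open>M \<ge> 2\<close> and \<open>M * a \<le> 1 / 2\<close>, the left
        side is at most \<open>1 / 4\<close> and the right side at least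
        \<open>1 / 2\<close>.\<close>
      have "a \<le> 1 - M * a_low"
      proof -
        have "2 * a \<le> M * a" using M a0 by simp
        then show ?thesis using a Ma by linarith
      qed
      then show ?thesis
        using lip[of a "a * \<lfloor>M * c\<rfloor>"] a0 K \<eta>(1) s unfolding fl
        by (intro mult_left_mono add_mono) (auto simp: S_def Suc distrib_left)
    qed
    finally have "p * \<bar>A\<bar> \<le> p * (K * (S * s + \<eta> * (\<rho> * t)))" using p by simp
    moreover have "S * (p * s + (1 - p) * (1 / s)) \<le> S * \<rho>"
      using sq[of "1 / s" s] \<rho>(1) S s inv_s by (intro mult_left_mono) auto
    then have "K * (S * (p * s + (1 - p) * (1 / s))) \<le> K * (S * \<rho>)"
      using K by (rule mult_left_mono)
    ultimately show ?thesis by (simp add: algebra_simps)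
  qed
  have "\<bar>p * A + (1 - p) / M * (\<Sum>j<M. B j)\<bar> \<le> p * \<bar>A\<bar> + (1 - p) / M * \<bar>\<Sum>j<M. B j\<bar>"
    using p by (intro order_trans[OF abs_triangle_ineq]) (simp add: abs_mult)
  also have "\<dots> \<le> K * (\<rho> * S + \<eta> * (\<rho> * t))" using A Bb by linarith
  finally show "\<bar>transfer M a h (u, c) - transfer M a h (u', c')\<bar> \<le> \<rho> * K * (1 / s ^ k + \<eta> * \<bar>u - u'\<bar> powr \<theta>)"
    unfolding eq by (simp add: S_def t_def algebra_simps)
qed


section \<open>Borel structure and measure of the half-open square\<close>

lemma borel_measurable_fst_snd [measurable]:
  "fst \<in> borel_measurable (borel :: (real \<times> real) measure)"
  "snd \<in> borel_measurable (borel :: (real \<times> real) measure)"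
  by (auto intro!: borel_measurable_continuous_onI continuous_intros)

lemma Q_borel [measurable]: "Q \<in> sets borel"
  unfolding Q_def by (intro borel_Times) auto

lemma emeasure_Q: "emeasure lborel Q = 1"
proof -
  have "emeasure (lborel \<Otimes>\<^sub>M lborel) ({0..<1::real} \<times> {0..<1::real}) = 1"
    by (subst lborel.emeasure_pair_measure_Times) auto
  then show ?thesis by (simp add: Q_def lborel_prod)
qed

section \<open>Duality with the baker maps\<close>

lemma integrable_on_Q:
  fixes F :: "real \<times> real \<Rightarrow> real"
  assumes "F \<in> borel_measurable borel" "\<And>x. \<bar>F x\<bar> \<le> B" "\<And>x. x \<notin> Q \<Longrightarrow> F x = 0"
  shows "integrable lborel F"
  by (rule integrableI_bounded_set[where A = Q and B = B]) (use assms in \<open>auto simp: emeasure_Q\<close>)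

text \<open>All branches are affine and act on the two coordinates separately, so this special
  change of variables serves every one of them.\<close>

lemma integral_affine_prod:
  fixes F :: "real \<times> real \<Rightarrow> real"
  assumes F: "F \<in> borel_measurable borel" and b: "b1 \<noteq> 0" "b2 \<noteq> 0"
  shows "integral\<^sup>L lborel F = \<bar>b1 * b2\<bar> * (\<integral>x. F (t1 + b1 * fst x, t2 + b2 * snd x) \<partial>lborel)"
proof -
  let ?T = "\<lambda>x::real \<times> real. (t1 + b1 * fst x, t2 + b2 * snd x)"
  have T: "(t1, t2) + (\<Sum>j\<in>Basis. (((b1, b2) \<bullet> j) * (x \<bullet> j)) *\<^sub>R j) = ?T x" for x
    by (cases x) (simp add: Basis_prod_def sum.union_disjoint)
  have "lborel = density (distr lborel borel ?T) (\<lambda>_. (\<Prod>j\<in>Basis. \<bar>(b1, b2) \<bullet> j\<bar>))"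
    using lborel_affine_euclidean[of "\<lambda>j. (b1, b2) \<bullet> j" "(t1, t2)"] b
    unfolding T by (force simp: Basis_prod_def)
  also have "(\<Prod>j\<in>(Basis :: (real \<times> real) set). \<bar>(b1, b2) \<bullet> j\<bar>) = \<bar>b1 * b2\<bar>"
    by (simp add: Basis_prod_def prod.union_disjoint abs_mult)
  finally have L: "lborel = density (distr lborel borel ?T) (\<lambda>_. ennreal \<bar>b1 * b2\<bar>)" .
  have [measurable]: "?T \<in> borel_measurable borel"
    by (intro borel_measurable_continuous_onI continuous_intros)
  show ?thesis
    by (subst L) (use F in \<open>simp add: integral_density integral_distr\<close>)
qed

text \<open>The branch index becomes a floor, counted from 0, so branch \<open>Suc d\<close> of the
  definition is meant. On \<open>Q\<close> the closed edge of the last \<beta>-piece is excluded,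
  which keeps the floor of \<open>M * c\<close> below \<open>M\<close>.\<close>

lemma baker_on_Q:
  fixes M :: nat and a u c :: real
  assumes a: "0 < a" "M * a < 1" "M \<ge> 1" and Q: "(u, c) \<in> Q"
  shows "u < M * a \<Longrightarrow> 0 \<le> \<lfloor>u / a\<rfloor> \<and> \<lfloor>u / a\<rfloor> < int M \<and>
      baker M a (u, c) = ((u - real (nat \<lfloor>u / a\<rfloor>) * a) / a, (c + real (nat \<lfloor>u / a\<rfloor>)) / M)"
    and "M * a \<le> u \<Longrightarrow>
      baker M a (u, c) = ((u - M * a) / (1 - M * a), M * c - real (nat \<lfloor>M * c\<rfloor>))"
    and "0 \<le> \<lfloor>M * c\<rfloor>" "\<lfloor>M * c\<rfloor> < int M"
proof -
  have uc: "0 \<le> u" "u < 1" "0 \<le> c" "c < 1" using Q by (auto simp: Q_def)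
  {
    assume u: "u < M * a"
    define d where "d = nat \<lfloor>u / a\<rfloor>"
    have fl: "0 \<le> \<lfloor>u / a\<rfloor>" using a uc by simp
    then have d: "real d \<le> u / a" "u / a < real d + 1" by (simp_all add: d_def)
    have dM: "\<lfloor>u / a\<rfloor> < int M" using u a by (simp add: floor_less_iff field_simps)
    then have "d < M" using fl d_def by linarith
    moreover have "(u, c) \<in> Omega_alpha M a (Suc d)"
      using d uc a by (simp add: Omega_alpha_def field_simps)
    ultimately show "0 \<le> \<lfloor>u / a\<rfloor> \<and> \<lfloor>u / a\<rfloor> < int M \<and>
      baker M a (u, c) = ((u - real (nat \<lfloor>u / a\<rfloor>) * a) / a, (c + real (nat \<lfloor>u / a\<rfloor>)) / M)"
      using baker_alpha[OF a(1), of "Suc d" M u c] fl dM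
      by (simp add: add_divide_distrib flip: d_def)
  }
  define d where "d = nat \<lfloor>M * c\<rfloor>"
  show fl: "0 \<le> \<lfloor>M * c\<rfloor>" using uc by simp
  then have d: "real d \<le> M * c" "M * c < real d + 1" by (simp_all add: d_def)
  show dM: "\<lfloor>M * c\<rfloor> < int M" using uc a by (simp add: floor_less_iff)
  then have dM': "d < M" using fl d_def by linarith
  assume u: "M * a \<le> u"
  have "(u, c) \<in> Omega_beta M a (Suc d)"
    using d uc u a dM' by (cases "Suc d < M") (auto simp: Omega_beta_def field_simps)
  then show "baker M a (u, c) = ((u - M * a) / (1 - M * a), M * c - real (nat \<lfloor>M * c\<rfloor>))"
    using baker_beta[OF a(1), of "Suc d" M u c] dM' by (simp flip: d_def)
qed

lemma baker_in_Q:
  fixes M :: nat and a :: real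
  assumes a: "0 < a" "M * a < 1" "M \<ge> 1" and x: "x \<in> Q"
  shows "baker M a x \<in> Q"
proof -
  obtain u c where [simp]: "x = (u, c)" by (cases x)
  have uc: "0 \<le> u" "u < 1" "0 \<le> c" "c < 1" using x by (auto simp: Q_def)
  note b = baker_on_Q[OF a x[simplified]]
  show ?thesis
  proof (cases "u < M * a")
    case True
    define d where "d = nat \<lfloor>u / a\<rfloor>"
    have "real d \<le> u / a" "u / a < real d + 1"
      using b(1)[OF True] by (simp_all add: d_def)
    moreover have "real d + 1 \<le> M" using b(1)[OF True] d_def by linarith
    ultimately show ?thesis
      using b(1)[OF True] uc a by (auto simp: Q_def field_simps simp flip: d_def)
  next
    case False
    have "real (nat \<lfloor>M * c\<rfloor>) \<le> M * c" "M * c < real (nat \<lfloor>M * c\<rfloor>) + 1"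
      using b(3) by simp_all
    then show ?thesis
      using b(2) False uc a by (auto simp: Q_def field_simps)
  qed
qed

section \<open>Splitting the square into branch domains\<close>

lemma sum_lessThan_floor:
  fixes z :: int and G :: "nat \<Rightarrow> 'a::comm_monoid_add"
  assumes "0 \<le> z" "z < int M"
  shows "(\<Sum>d<M. if z = int d then G d else 0) = G (nat z)"
proof -
  have "(\<Sum>d<M. if z = int d then G d else 0) = (\<Sum>d<M. if d = nat z then G d else 0)"
    using assms by (intro sum.cong) auto
  also have "\<dots> = G (nat z)" using assms by (subst sum.delta) auto
  finally show ?thesis .
qed

text \<open>Unlike \<open>Omega_alpha\<close> and \<open>Omega_beta\<close>, the cells are half-open
  throughout and indexed from 0; those with \<open>d < M\<close> partition \<open>Q\<close>
  exactly.\<close>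

definition alpha_cell :: "real \<Rightarrow> nat \<Rightarrow> (real \<times> real) set" where
  "alpha_cell a d = {real d * a..<(real d + 1) * a} \<times> {0..<1}"

definition beta_cell :: "nat \<Rightarrow> real \<Rightarrow> nat \<Rightarrow> (real \<times> real) set" where
  "beta_cell M a d = {M * a..<1} \<times> {real d / M..<(real d + 1) / M}"

lemma cell_borel [measurable]: "alpha_cell a d \<in> sets borel" "beta_cell M a d \<in> sets borel"
  unfolding alpha_cell_def beta_cell_def by (auto intro!: borel_Times)

lemma cell_iff:
  fixes M :: nat and a u c :: real
  assumes "0 < a" "M \<ge> 1" "(u, c) \<in> Q"
  shows "(u, c) \<in> alpha_cell a d \<longleftrightarrow> \<lfloor>u / a\<rfloor> = int d"
    and "(u, c) \<in> beta_cell M a d \<longleftrightarrow> M * a \<le> u \<and> \<lfloor>M * c\<rfloor> = int d"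
  using assms by (auto simp: alpha_cell_def beta_cell_def Q_def floor_eq_iff field_simps)

lemma cell_subset_Q:
  fixes M :: nat and a :: real
  assumes "0 < a" "M * a < 1" "d < M"
  shows "alpha_cell a d \<subseteq> Q" "beta_cell M a d \<subseteq> Q"
proof -
  have d: "real d + 1 \<le> M" using assms(3) by linarith
  have "(real d + 1) * a \<le> M * a" using d assms by (intro mult_right_mono) auto
  then have "x < 1" if "x < (real d + 1) * a" for x using that assms by linarith
  moreover have "0 \<le> x" if "real d * a \<le> x" for x
    using that assms by (meson mult_nonneg_nonneg less_imp_le of_nat_0_le_iff order_trans)
  ultimately show "alpha_cell a d \<subseteq> Q" by (auto simp: alpha_cell_def Q_def)
  have "(real d + 1) / M \<le> 1" using d by simp
  then have "x < 1" if "x < (real d + 1) / M" for x using that by linarith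
  moreover have "0 \<le> x" if "real d / M \<le> x" for x
    using that by (meson divide_nonneg_nonneg of_nat_0_le_iff order_trans)
  moreover have "0 \<le> x" if "M * a \<le> x" for x
    using that assms by (meson mult_nonneg_nonneg less_imp_le of_nat_0_le_iff order_trans)
  ultimately show "beta_cell M a d \<subseteq> Q" by (auto simp: beta_cell_def Q_def)
qed

text \<open>Exactly one cell contains a given point of \<open>Q\<close>, so a single summand
  survives. The map is thereby replaced by explicit affine formulas, which yields measurability and
  permits integration branch by branch.\<close>

lemma baker_branch_sum:
  fixes M :: nat and a :: real and x :: "real \<times> real" and F :: "real \<times> real \<Rightarrow> real \<times> real \<Rightarrow> real"
  assumes a: "0 < a" "M * a < 1" "M \<ge> 1"
  shows "indicator Q x * F x (baker M a x) =
    (\<Sum>d<M. indicator (alpha_cell a d) x * F x ((fst x - real d * a) / a, (snd x + real d) / M)) +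
    (\<Sum>d<M. indicator (beta_cell M a d) x * F x ((fst x - M * a) / (1 - M * a), M * snd x - real d))"
    (is "_ = (\<Sum>d<M. ?A d) + (\<Sum>d<M. ?B d)")
proof (cases "x \<in> Q")
  case False
  then have "x \<notin> alpha_cell a d" "x \<notin> beta_cell M a d" if "d < M" for d
    using cell_subset_Q[OF a(1,2) that] by auto
  then have "(\<Sum>d<M. ?A d) = 0" "(\<Sum>d<M. ?B d) = 0"
    by (auto intro!: sum.neutral)
  then show ?thesis using False by simp
next
  case True
  obtain u c where [simp]: "x = (u, c)" by (cases x)
  note b = baker_on_Q[OF a True[simplified]]
  note cell = cell_iff[OF a(1,3) True[simplified]]
  have A: "?A d = (if \<lfloor>u / a\<rfloor> = int d then F x ((u - real d * a) / a, (c + real d) / M) else 0)" for d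
    by (simp add: cell indicator_def)
  have B: "?B d = (if M * a \<le> u \<and> \<lfloor>M * c\<rfloor> = int d
      then F x ((u - M * a) / (1 - M * a), M * c - real d) else 0)" for d
    by (simp add: cell indicator_def)
  show ?thesis
  proof (cases "u < M * a")
    case u: True
    then have "(\<Sum>d<M. ?B d) = 0" unfolding B by simp
    moreover have "(\<Sum>d<M. ?A d) = F x (baker M a x)"
      using b(1)[OF u] unfolding A by (subst sum_lessThan_floor) auto
    ultimately show ?thesis using True by simp
  next
    case u: False
    have "int M \<le> \<lfloor>u / a\<rfloor>" using u a by (simp add: le_floor_iff field_simps)
    then have "(\<Sum>d<M. ?A d) = 0" unfolding A by (intro sum.neutral) auto
    moreover have "(\<Sum>d<M. ?B d) = F x (baker M a x)"
      using b(2,3,4) u unfolding B by (simp add: sum_lessThan_floor)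
    ultimately show ?thesis using True by simp
  qed
qed

section \<open>One-step duality\<close>

lemma measurable_indicator_baker:
  fixes M :: nat and a :: real and \<phi> :: "real \<times> real \<Rightarrow> real"
  assumes "0 < a" "M * a < 1" "M \<ge> 1" and [measurable]: "\<phi> \<in> borel_measurable borel"
  shows "(\<lambda>x. indicator Q x * \<phi> (baker M a x)) \<in> borel_measurable borel"
  unfolding baker_branch_sum[OF assms(1-3), of _ "\<lambda>_. \<phi>"] by measurable

lemma measurable_transfer [measurable]:
  assumes [measurable]: "h \<in> borel_measurable borel"
  shows "transfer M a h \<in> borel_measurable borel"
proof -
  have [measurable]: "(\<lambda>x::real \<times> real. real_of_int \<lfloor>real M * snd x\<rfloor>) \<in> borel_measurable borel"
    by (rule measurable_compose[OF _ borel_measurable_real_floor]) measurable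
  have "transfer M a h = (\<lambda>x. M * a * h (a * (fst x + real_of_int \<lfloor>real M * snd x\<rfloor>), frac (real M * snd x)) +
     (1 - M * a) / M * (\<Sum>j<M. h ((1 - M * a) * fst x + M * a, (snd x + real j) / M)))"
    by (auto simp: transfer_def fun_eq_iff)
  also have "\<dots> \<in> borel_measurable borel" unfolding frac_def by measurable
  finally show ?thesis .
qed

text \<open>The weights of the inverse branches are nonnegative and sum to 1.\<close>

lemma transfer_bounded:
  fixes M :: nat and a :: real
  assumes "0 \<le> a" "M * a \<le> 1" "M \<ge> 1" and h: "\<And>x. \<bar>h x\<bar> \<le> B"
  shows "\<bar>transfer M a h x\<bar> \<le> B"
proof -
  obtain u c where [simp]: "x = (u, c)" by (cases x)
  let ?S = "\<Sum>j<M. h ((1 - M * a) * u + M * a, (c + real j) / M)"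
  have "\<bar>?S\<bar> \<le> (\<Sum>j<M. B)" using h by (intro order_trans[OF sum_abs] sum_mono) auto
  then have "(1 - M * a) / M * \<bar>?S\<bar> \<le> (1 - M * a) / M * (M * B)"
    using assms by (intro mult_left_mono) auto
  also have "\<dots> = (1 - M * a) * B" using assms by simp
  finally have "\<bar>(1 - M * a) / M * ?S\<bar> \<le> (1 - M * a) * B"
    using assms by (simp add: abs_mult)
  moreover have "\<bar>M * a * h (a * (u + real_of_int \<lfloor>real M * c\<rfloor>), frac (real M * c))\<bar> \<le> M * a * B"
    using assms by (simp add: abs_mult mult_left_mono)
  moreover have "M * a * B + (1 - M * a) * B = B" by (simp add: algebra_simps)
  ultimately show ?thesis unfolding transfer_def \<open>x = (u, c)\<close> prod.case by linarith
qed

text \<open>The left integral is split over the cells and each piece is pulled back by its inverse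
  branch. The Jacobians \<open>M * a\<close> and \<open>(1 - M * a) / M\<close> are precisely the
  weights in \<open>transfer\<close>.\<close>

lemma transfer_duality:
  fixes M :: nat and a :: real and \<phi> h :: "real \<times> real \<Rightarrow> real"
  assumes a: "0 < a" "M * a < 1" "M \<ge> 1"
    and [measurable]: "\<phi> \<in> borel_measurable borel" "h \<in> borel_measurable borel"
    and bnd: "\<And>x. \<bar>\<phi> x\<bar> \<le> 1" "\<And>x. \<bar>h x\<bar> \<le> B"
  shows "(\<integral>x. indicator Q x * (\<phi> (baker M a x) * h x) \<partial>lborel) =
    (\<integral>x. indicator Q x * (\<phi> x * transfer M a h x) \<partial>lborel)"
proof -
  have prod: "\<bar>\<phi> x * h y\<bar> \<le> B" for x y
    using mult_mono[OF bnd(1)[of x] bnd(2)[of y]] by (simp add: abs_mult)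
  have ind: "\<bar>indicator S x * (\<phi> y * h z)\<bar> \<le> B" for S and x y z :: "real \<times> real"
    using prod[of y z] by (auto simp: indicator_def)
  \<comment> \<open>\<open>f\<close> and \<open>g\<close> are the integrand on the two kinds of
    cells; \<open>f'\<close> and \<open>g'\<close> are the same pieces after the change of
    variables, without the Jacobian factor.\<close>
  define f where "f d x = indicator (alpha_cell a d) x * (\<phi> ((fst x - real d * a) / a, (snd x + real d) / M) * h x)"
    for d :: nat and x :: "real \<times> real"
  define g where "g d x = indicator (beta_cell M a d) x * (\<phi> ((fst x - M * a) / (1 - M * a), M * snd x - real d) * h x)"
    for d :: nat and x :: "real \<times> real"
  define f' where "f' d x = indicator (Q \<inter> {x. \<lfloor>M * snd x\<rfloor> = int d}) x *
      (\<phi> x * h (a * (fst x + real d), M * snd x - real d))" for d :: nat and x :: "real \<times> real"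
  define g' where "g' d x = indicator Q x *
      (\<phi> x * h ((1 - M * a) * fst x + M * a, (snd x + real d) / M))" for d :: nat and x :: "real \<times> real"
  have [measurable]: "f d \<in> borel_measurable borel" "g d \<in> borel_measurable borel"
      "f' d \<in> borel_measurable borel" "g' d \<in> borel_measurable borel" for d
    unfolding f_def[abs_def] g_def[abs_def] f'_def[abs_def] g'_def[abs_def] by measurable
  have intg: "integrable lborel (f d)" "integrable lborel (g d)" if "d < M" for d
    using cell_subset_Q[OF a(1,2) that] ind
    by (auto intro!: integrable_on_Q[where B = B] simp: f_def g_def indicator_def)
  have bnd': "\<bar>f' d x\<bar> \<le> B" "\<bar>g' d x\<bar> \<le> B" for d x
    unfolding f'_def g'_def by (rule ind)+
  have intg': "integrable lborel (f' d)" "integrable lborel (g' d)" for d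
    by (rule integrable_on_Q[OF _ bnd'(1)], simp, simp add: f'_def)
      (rule integrable_on_Q[OF _ bnd'(2)], simp, simp add: g'_def)
  have M0: "real M > 0" using a by simp
  have f: "integral\<^sup>L lborel (f d) = M * a * integral\<^sup>L lborel (f' d)" if d: "d < M" for d
  proof -
    have "f d (real d * a + a * fst x, - real d + M * snd x) = f' d x" for x :: "real \<times> real"
    proof -
      have "(real d * a + a * fst x, - real d + M * snd x) \<in> alpha_cell a d \<longleftrightarrow>
          0 \<le> fst x \<and> fst x < 1 \<and> real d \<le> M * snd x \<and> M * snd x < real d + 1"
        using a(1) mult_less_cancel_left_pos[OF a(1), of "fst x" 1]
        by (simp add: alpha_cell_def distrib_right zero_le_mult_iff) linarith
      also have "\<dots> \<longleftrightarrow> x \<in> Q \<inter> {x. \<lfloor>M * snd x\<rfloor> = int d}"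
      proof -
        have "0 \<le> snd x" if "real d \<le> M * snd x"
          using that M0 by (smt (verit) of_nat_0_le_iff zero_le_mult_iff)
        moreover have "snd x < 1" if "M * snd x < real d + 1"
        proof -
          have "M * snd x < M * 1" using that d by linarith
          then show ?thesis using M0 by simp
        qed
        ultimately show ?thesis by (cases x) (auto simp: Q_def floor_eq_iff)
      qed
      finally have "(real d * a + a * fst x, - real d + M * snd x) \<in> alpha_cell a d \<longleftrightarrow> \<dots>" .
      moreover have "real d * a + a * fst x = a * (fst x + real d)" "- real d + M * snd x = M * snd x - real d"
          "(a * (fst x + real d) - real d * a) / a = fst x"
        using a(1) by (simp_all add: field_simps)
      ultimately show ?thesis
        using a(1) M0 by (simp add: f_def f'_def indicator_def)
    qed
    then show ?thesis
      using integral_affine_prod[of "f d" a "real M" "real d * a" "- real d"] a M0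
      by (simp add: mult.commute)
  qed
  have g: "integral\<^sup>L lborel (g d) = (1 - M * a) / M * integral\<^sup>L lborel (g' d)" for d
  proof -
    have "g d (M * a + (1 - M * a) * fst x, real d / M + 1 / M * snd x) = g' d x" for x :: "real \<times> real"
    proof -
      have "M * a + (1 - M * a) * fst x < 1 \<longleftrightarrow> (1 - M * a) * fst x < (1 - M * a) * 1"
        unfolding mult_1_right by linarith
      also have "\<dots> \<longleftrightarrow> fst x < 1" using a by (subst mult_less_cancel_left_pos) auto
      finally have "(M * a + (1 - M * a) * fst x, real d / M + 1 / M * snd x) \<in> beta_cell M a d \<longleftrightarrow> x \<in> Q"
        using a M0
        by (cases x) (auto simp: beta_cell_def Q_def add_divide_distrib zero_le_mult_iff zero_le_divide_iff divide_less_eq)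
      moreover have "real d / M + 1 / M * snd x = (snd x + real d) / M"
        by (simp add: add_divide_distrib)
      moreover have "(M * a + (1 - M * a) * fst x - M * a) / (1 - M * a) = fst x"
        "M * ((snd x + real d) / M) - real d = snd x"
        using a M0 by simp_all
      moreover have "M * a + (1 - M * a) * fst x = (1 - M * a) * fst x + M * a" by simp
      ultimately show ?thesis
        by (simp only: g_def g'_def indicator_def fst_conv snd_conv prod.collapse)
    qed
    then show ?thesis
      using integral_affine_prod[of "g d" "1 - M * a" "1 / M" "M * a" "real d / M"] a M0
      by simp
  qed
  \<comment> \<open>The images of the \<alpha>-cells are the strips of constant leading digit, so
    their contributions merge into one term governed by the digit of \<open>c\<close>.\<close>
  have sum_f': "(\<Sum>d<M. f' d (u, c)) =
      indicator Q (u, c) * (\<phi> (u, c) * h (a * (u + real_of_int \<lfloor>M * c\<rfloor>), frac (M * c)))" for u c :: real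
  proof (cases "(u, c) \<in> Q")
    case True
    have "(\<Sum>d<M. f' d (u, c)) =
        (\<Sum>d<M. if \<lfloor>M * c\<rfloor> = int d then \<phi> (u, c) * h (a * (u + real d), M * c - real d) else 0)"
      using True by (intro sum.cong) (auto simp: f'_def)
    then show ?thesis
      using True baker_on_Q(3,4)[OF a True] by (simp add: sum_lessThan_floor frac_def)
  qed (simp add: f'_def)
  have "(\<integral>x. indicator Q x * (\<phi> (baker M a x) * h x) \<partial>lborel) =
      (\<integral>x. (\<Sum>d<M. f d x) + (\<Sum>d<M. g d x) \<partial>lborel)"
    unfolding f_def g_def using baker_branch_sum[OF a, of _ "\<lambda>x y. \<phi> y * h x"] by simp
  also have "\<dots> = (\<Sum>d<M. integral\<^sup>L lborel (f d)) + (\<Sum>d<M. integral\<^sup>L lborel (g d))"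
    using intg by (subst Bochner_Integration.integral_add) auto
  also have "\<dots> = M * a * (\<Sum>d<M. integral\<^sup>L lborel (f' d)) +
      (1 - M * a) / M * (\<Sum>d<M. integral\<^sup>L lborel (g' d))"
    by (simp add: f g sum_distrib_left)
  also have "\<dots> = (\<integral>x. M * a * (\<Sum>d<M. f' d x) + (1 - M * a) / M * (\<Sum>d<M. g' d x) \<partial>lborel)"
    using intg' by (subst Bochner_Integration.integral_add) auto
  also have "\<dots> = (\<integral>x. indicator Q x * (\<phi> x * transfer M a h x) \<partial>lborel)"
  proof (rule Bochner_Integration.integral_cong[OF refl])
    fix x :: "real \<times> real"
    show "M * a * (\<Sum>d<M. f' d x) + (1 - M * a) / M * (\<Sum>d<M. g' d x) =
        indicator Q x * (\<phi> x * transfer M a h x)"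
      by (cases x) (simp add: sum_f' g'_def transfer_def sum_distrib_left algebra_simps)
  qed
  finally show ?thesis .
qed


section \<open>Iteration along the parameter sequence\<close>

primrec transfer_iter :: "nat \<Rightarrow> (nat \<Rightarrow> real) \<Rightarrow> nat \<Rightarrow> (real \<times> real \<Rightarrow> real) \<Rightarrow> real \<times> real \<Rightarrow> real" where
  "transfer_iter M a 0 h = h"
| "transfer_iter M a (Suc n) h = transfer M (a (Suc n)) (transfer_iter M a n h)"

lemma baker_comp_0: "baker_comp M a 1 0 = id"
  by (simp add: baker_comp_def)

lemma baker_comp_Suc: "baker_comp M a 1 (Suc n) = baker M (a (Suc n)) \<circ> baker_comp M a 1 n"
  by (simp add: baker_comp_def fun_eq_iff)

context
  fixes M :: nat and a :: "nat \<Rightarrow> real"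
  assumes M: "M \<ge> 1" and a: "\<And>k. k \<ge> 1 \<Longrightarrow> 0 < a k" "\<And>k. k \<ge> 1 \<Longrightarrow> M * a k < 1"
begin

lemma baker_comp_in_Q: "x \<in> Q \<Longrightarrow> baker_comp M a 1 n x \<in> Q"
proof (induction n)
  case (Suc n)
  then show ?case using baker_in_Q[OF a(1) a(2) M] unfolding baker_comp_Suc by simp
qed (simp only: baker_comp_0 id_apply)

lemma measurable_baker_comp: "baker_comp M a 1 n \<in> leb_X \<rightarrow>\<^sub>M leb_X"
proof (induction n)
  case (Suc n)
  show ?case unfolding baker_comp_Suc
    by (rule measurable_comp[OF Suc measurable_baker[OF a(1) a(2) M]]) auto
qed (simp only: baker_comp_0 measurable_ident)

lemma measurable_transfer_iter [measurable]:
  "h \<in> borel_measurable borel \<Longrightarrow> transfer_iter M a n h \<in> borel_measurable borel"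
  by (induction n) auto

lemma transfer_iter_bounded:
  assumes "\<And>x. \<bar>h x\<bar> \<le> B"
  shows "\<bar>transfer_iter M a n h x\<bar> \<le> B"
proof (induction n arbitrary: x)
  case (Suc n)
  have "0 \<le> a (Suc n)" "M * a (Suc n) \<le> 1" using a(1)[of "Suc n"] a(2)[of "Suc n"] by auto
  then show ?case using transfer_bounded[OF _ _ M Suc.IH] by simp
qed (use assms in simp)

text \<open>The last map is absorbed into the test function, the induction hypothesis handles the
  first \<open>n\<close> maps, and one-step duality moves the last map onto the density. Hence the
  induction varies \<open>\<phi>\<close>.\<close>

lemma baker_comp_duality:
  assumes [measurable]: "\<phi> \<in> borel_measurable borel" and h [measurable]: "h \<in> borel_measurable borel"
    and bnd: "\<And>x. \<bar>\<phi> x\<bar> \<le> 1" "\<And>x. \<bar>h x\<bar> \<le> B"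
  shows "(\<integral>x. indicator Q x * (\<phi> (baker_comp M a 1 n x) * h x) \<partial>lborel) =
    (\<integral>x. indicator Q x * (\<phi> x * transfer_iter M a n h x) \<partial>lborel)"
  using assms(1) bnd(1)
proof (induction n arbitrary: \<phi>)
  case (Suc n)
  note aS = a(1)[of "Suc n"] a(2)[of "Suc n"]
  note [measurable] = Suc.prems(1)
  \<comment> \<open>Cutting off outside \<open>Q\<close> makes the composite Borel on the whole
    plane; it changes nothing along orbits, since \<open>Q\<close> is invariant.\<close>
  define \<psi> where "\<psi> x = indicator Q x * \<phi> (baker M (a (Suc n)) x)" for x
  have "(\<integral>x. indicator Q x * (\<phi> (baker_comp M a 1 (Suc n) x) * h x) \<partial>lborel) =
      (\<integral>x. indicator Q x * (\<psi> (baker_comp M a 1 n x) * h x) \<partial>lborel)"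
    using baker_comp_in_Q
    by (intro Bochner_Integration.integral_cong refl) (auto simp: indicator_def \<psi>_def baker_comp_Suc simp del: One_nat_def)
  also have "\<dots> = (\<integral>x. indicator Q x * (\<psi> x * transfer_iter M a n h x) \<partial>lborel)"
  proof (rule Suc.IH)
    show "\<psi> \<in> borel_measurable borel"
      unfolding \<psi>_def[abs_def] using aS M by (intro measurable_indicator_baker) auto
    show "\<bar>\<psi> x\<bar> \<le> 1" for x
      using Suc.prems(2) by (simp add: \<psi>_def indicator_def)
  qed
  also have "\<dots> = (\<integral>x. indicator Q x * (\<phi> (baker M (a (Suc n)) x) * transfer_iter M a n h x) \<partial>lborel)"
    by (intro Bochner_Integration.integral_cong refl) (auto simp: indicator_def \<psi>_def)
  also have "\<dots> = (\<integral>x. indicator Q x * (\<phi> x * transfer M (a (Suc n)) (transfer_iter M a n h) x) \<partial>lborel)"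
    using aS M Suc.prems(2) transfer_iter_bounded[OF bnd(2)]
    by (intro transfer_duality[where B = B]) auto
  finally show ?case by simp
qed (simp only: baker_comp_0 id_apply transfer_iter.simps)

text \<open>On a space of mass 1, a function of mean 1 differs from 1 by at most its
  oscillation.\<close>

lemma transfer_iter_close_to_1:
  assumes h [measurable]: "h \<in> borel_measurable borel" and bnd: "\<And>x. \<bar>h x\<bar> \<le> B"
    and int: "(\<integral>x. indicator Q x * h x \<partial>lborel) = 1"
    and osc: "\<And>x y. x \<in> Q \<Longrightarrow> y \<in> Q \<Longrightarrow> \<bar>transfer_iter M a n h x - transfer_iter M a n h y\<bar> \<le> \<epsilon>"
    and x: "x \<in> Q"
  shows "\<bar>transfer_iter M a n h x - 1\<bar> \<le> \<epsilon>"
proof -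
  let ?P = "transfer_iter M a n h"
  \<comment> \<open>Duality against the constant 1 says that the transfer operators preserve the
    integral.\<close>
  have int1: "(\<integral>x. indicator Q x * ?P x \<partial>lborel) = 1"
    using baker_comp_duality[of "\<lambda>_. 1" h B n] bnd int by simp
  have intc: "integrable lborel (\<lambda>y. indicator Q y * c)" "(\<integral>y. indicator Q y * c \<partial>lborel) = c" for c :: real
    by (auto simp: emeasure_Q measure_def)
  have intP: "integrable lborel (\<lambda>y. indicator Q y * ?P y)"
  proof (rule integrable_on_Q[where B = B])
    show "\<bar>indicator Q y * ?P y\<bar> \<le> B" for y
      using transfer_iter_bounded[of h B n y, OF bnd] order_trans[OF abs_ge_zero bnd[of y]]
      by (auto simp: indicator_def)
  qed auto
  have "(\<integral>y. indicator Q y * ?P y \<partial>lborel) \<le> (\<integral>y. indicator Q y * (?P x + \<epsilon>) \<partial>lborel)"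
    using osc[OF _ x] by (intro integral_mono intP intc) (auto simp: indicator_def abs_le_iff algebra_simps)
  moreover have "(\<integral>y. indicator Q y * (?P x - \<epsilon>) \<partial>lborel) \<le> (\<integral>y. indicator Q y * ?P y \<partial>lborel)"
    using osc[OF _ x] by (intro integral_mono intP intc) (auto simp: indicator_def abs_le_iff algebra_simps)
  ultimately show ?thesis unfolding int1 intc by linarith
qed

text \<open>Duality against the indicator of \<open>A\<close> turns the pushforward into the
  integral of the transferred density over \<open>Q \<inter> A\<close>. Keeping the error
  proportional to the measure of that set lets it be summed over a partition.\<close>

lemma pushforward_close_to_lebesgue:
  assumes h [measurable]: "h \<in> borel_measurable borel" and bnd: "\<And>x. \<bar>h x\<bar> \<le> B"
    and int: "(\<integral>x. indicator Q x * h x \<partial>lborel) = 1"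
    and osc: "\<And>x y. x \<in> Q \<Longrightarrow> y \<in> Q \<Longrightarrow> \<bar>transfer_iter M a n h x - transfer_iter M a n h y\<bar> \<le> \<epsilon>"
    and A [measurable]: "A \<in> sets borel"
  shows "\<bar>(\<integral>x. indicator Q x * (indicator A (baker_comp M a 1 n x) * h x) \<partial>lborel) - measure lborel (Q \<inter> A)\<bar>
    \<le> \<epsilon> * measure lborel (Q \<inter> A)"
proof -
  let ?P = "transfer_iter M a n h"
  have eq: "(\<integral>x. indicator Q x * (indicator A (baker_comp M a 1 n x) * h x) \<partial>lborel) =
      (\<integral>x. indicator (Q \<inter> A) x * ?P x \<partial>lborel)" (is "?l = ?r")
    using baker_comp_duality[of "indicator A" h B n] bnd by (simp add: indicator_inter_arith mult.assoc)
  have "emeasure lborel (Q \<inter> A) \<le> emeasure lborel Q" by (intro emeasure_mono) auto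
  then have fin: "emeasure lborel (Q \<inter> A) < \<infinity>" by (simp add: emeasure_Q order_le_less_trans)
  have intc: "integrable lborel (\<lambda>y. indicator (Q \<inter> A) y * c)"
      "(\<integral>y. indicator (Q \<inter> A) y * c \<partial>lborel) = measure lborel (Q \<inter> A) * c" for c :: real
    using fin by auto
  have intP: "integrable lborel (\<lambda>y. indicator (Q \<inter> A) y * ?P y)"
  proof (rule integrable_on_Q[where B = B])
    show "\<bar>indicator (Q \<inter> A) y * ?P y\<bar> \<le> B" for y
      using transfer_iter_bounded[of h B n y, OF bnd] order_trans[OF abs_ge_zero bnd[of y]]
      by (auto simp: indicator_def)
  qed auto
  have close: "\<bar>?P x - 1\<bar> \<le> \<epsilon>" if "x \<in> Q" for x
    using transfer_iter_close_to_1[OF h bnd int osc that] .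
  have "?r \<le> (\<integral>y. indicator (Q \<inter> A) y * (1 + \<epsilon>) \<partial>lborel)"
    using close by (intro integral_mono intP intc) (auto simp: indicator_def abs_le_iff algebra_simps)
  moreover have "(\<integral>y. indicator (Q \<inter> A) y * (1 - \<epsilon>) \<partial>lborel) \<le> ?r"
    using close by (intro integral_mono intP intc) (auto simp: indicator_def abs_le_iff algebra_simps)
  ultimately show ?thesis unfolding eq intc by (simp add: abs_le_iff algebra_simps)
qed

text \<open>\<open>a_low\<close> and \<open>q\<close> bound all parameters at once, so the same
  \<open>s\<close>, \<open>\<eta>\<close> and \<open>\<rho>\<close> work at every step although the
  maps vary.\<close>

lemma transfer_iter_digit_holder:
  fixes a_low q s \<eta> \<theta> \<rho> K :: real
  assumes "M \<ge> 2" and "0 < a_low" "\<And>k. k \<ge> 1 \<Longrightarrow> a_low \<le> a k" "\<And>k. k \<ge> 1 \<Longrightarrow> M * a k \<le> q" "q \<le> 1 / 2"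
    and "0 < \<theta>" "1 < s" "0 \<le> \<eta>" "\<eta> \<le> q * (s - 1)" "0 \<le> K" "0 \<le> \<rho>"
    and "q * s + (1 - q) / s \<le> \<rho>" "(1 - M * a_low) powr \<theta> \<le> \<rho>"
    and "digit_holder M s \<eta> \<theta> K h"
  shows "digit_holder M s \<eta> \<theta> (\<rho> ^ n * K) (transfer_iter M a n h)"
proof (induction n)
  case (Suc n)
  have "digit_holder M s \<eta> \<theta> (\<rho> * (\<rho> ^ n * K)) (transfer M (a (Suc n)) (transfer_iter M a n h))"
    by (rule transfer_digit_holder[of M a_low "a (Suc n)" q]) (use assms Suc in auto)
  then show ?case by (simp add: mult.assoc)
qed (use assms in simp)

end

text \<open>Any two points share 0 digits, and then the weight is at most
  \<open>1 + \<eta> \<le> 2\<close>.\<close>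

lemma digit_holder_osc:
  assumes "digit_holder M s \<eta> \<theta> K h" "0 \<le> K" "0 \<le> \<eta>" "\<eta> \<le> 1" "0 < \<theta>" "x \<in> Q" "y \<in> Q"
  shows "\<bar>h x - h y\<bar> \<le> 2 * K"
proof -
  obtain u c u' c' where xy: "x = (u, c)" "y = (u', c')" by (cases x, cases y)
  have "\<bar>u - u'\<bar> powr \<theta> \<le> 1"
    using assms(5-7) by (intro powr_le1) (auto simp: Q_def xy)
  then have "\<eta> * \<bar>u - u'\<bar> powr \<theta> \<le> 1" using assms(3,4) by (simp add: mult_le_one)
  moreover have "\<bar>h (u, c) - h (u', c')\<bar> \<le> K * (1 / s ^ 0 + \<eta> * \<bar>u - u'\<bar> powr \<theta>)"
    using assms(1,6,7) unfolding digit_holder_def xy by (metis same_digits.simps(1))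
  ultimately show ?thesis
    using mult_left_mono[of "1 + \<eta> * \<bar>u - u'\<bar> powr \<theta>" 2 K] assms(2) by (simp add: xy)
qed

section \<open>Hoelder densities and total variation\<close>

text \<open>Sharing \<open>k\<close> digits bounds the \<open>c\<close>-distance by
  \<open>M^-k\<close>, whose power \<open>\<theta>\<close> is at most \<open>s^-k\<close> because
  \<open>s \<le> M powr \<theta>\<close>. The factor 2 comes from comparing the Euclidean distance
  with the maximum norm, and \<open>1 / \<eta>\<close> compensates the small weight of the
  \<open>u\<close>-term.\<close>

lemma holder_imp_digit_holder:
  fixes M :: nat and L \<theta> s \<eta> :: real
  assumes M: "M \<ge> 1" and \<theta>: "0 < \<theta>" "\<theta> \<le> 1" and s: "0 < s" "s \<le> M powr \<theta>"
    and \<eta>: "0 < \<eta>" "\<eta> \<le> 1" and L: "0 \<le> L"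
    and h: "\<And>x y. x \<in> Q \<Longrightarrow> y \<in> Q \<Longrightarrow> \<bar>h x - h y\<bar> \<le> L * dist x y powr \<theta>"
  shows "digit_holder M s \<eta> \<theta> (2 * L / \<eta>) h"
  unfolding digit_holder_def
proof (intro allI impI)
  fix k u u' c c'
  assume x: "(u, c) \<in> Q" "(u', c') \<in> Q" and k: "same_digits M k c c'"
  define t where "t = \<bar>u - u'\<bar> powr \<theta>"
  have "\<bar>c - c'\<bar> \<le> 1 / real M ^ k"
    using x by (intro same_digits_dist M k) (auto simp: Q_def)
  then have "\<bar>c - c'\<bar> powr \<theta> \<le> (1 / real M ^ k) powr \<theta>"
    using \<theta> by (intro powr_mono2) auto
  also have "\<dots> = 1 / (M powr \<theta>) ^ k"
    using M by (simp add: powr_divide powr_powr mult.commute flip: powr_realpow)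
  also have "\<dots> \<le> 1 / s ^ k"
    using s M by (intro divide_left_mono power_mono mult_pos_pos zero_less_power) auto
  finally have c: "\<bar>c - c'\<bar> powr \<theta> \<le> 1 / s ^ k" .
  let ?m = "max \<bar>u - u'\<bar> \<bar>c - c'\<bar>"
  have "dist (u, c) (u', c') \<le> \<bar>u - u'\<bar> + \<bar>c - c'\<bar>"
    using sqrt_sum_squares_le_sum_abs[of "u - u'" "c - c'"] by (simp add: dist_prod_def dist_real_def)
  also have "\<dots> \<le> 2 * ?m" by (auto simp: max_def)
  finally have "dist (u, c) (u', c') powr \<theta> \<le> (2 * ?m) powr \<theta>"
    using \<theta> by (intro powr_mono2) auto
  also have "\<dots> = 2 powr \<theta> * ?m powr \<theta>" by (simp add: powr_mult)
  also have "\<dots> \<le> 2 * (t + 1 / s ^ k)"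
  proof (rule mult_mono)
    show "2 powr \<theta> \<le> (2::real)" using powr_mono[of \<theta> 1 2] \<theta> by simp
    have "?m powr \<theta> = t \<or> ?m powr \<theta> = \<bar>c - c'\<bar> powr \<theta>" by (auto simp: max_def t_def)
    moreover have "0 \<le> t" "0 \<le> 1 / s ^ k" using s by (auto simp: t_def)
    ultimately show "?m powr \<theta> \<le> t + 1 / s ^ k" using c by linarith
  qed auto
  finally have "L * dist (u, c) (u', c') powr \<theta> \<le> L * (2 * (t + 1 / s ^ k))"
    using L by (rule mult_left_mono)
  also have "\<dots> \<le> 2 * L / \<eta> * (1 / s ^ k + \<eta> * t)"
  proof -
    have "2 * L * (1 / s ^ k) * \<eta> \<le> 2 * L * (1 / s ^ k) * 1"
      using L s \<eta> by (intro mult_left_mono) auto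
    then show ?thesis using \<eta>(1) by (simp add: field_simps)
  qed
  finally show "\<bar>h (u, c) - h (u', c')\<bar> \<le> 2 * L / \<eta> * (1 / s ^ k + \<eta> * \<bar>u - u'\<bar> powr \<theta>)"
    using h[OF x] by (simp add: t_def)
qed

section \<open>Regular versions of densities, and bounds on total variation\<close>

lemma holder_seminormD:
  assumes "holder_seminorm \<theta> g \<le> ereal L" "x \<in> X" "y \<in> X"
  shows "\<bar>g x - g y\<bar> \<le> L * dist x y powr \<theta>"
proof (cases "x = y")
  case False
  then have "ereal (\<bar>g x - g y\<bar> / dist x y powr \<theta>) \<le> holder_seminorm \<theta> g"
    unfolding holder_seminorm_def using assms(2,3)
    by (intro SUP_upper2[where i = "(x, y)"]) auto
  then have "\<bar>g x - g y\<bar> / dist x y powr \<theta> \<le> L"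
    using assms(1) by (metis ereal_less_eq(3) order_trans)
  then show ?thesis using False by (simp add: divide_le_eq)
qed simp

lemma holder_continuous_on:
  fixes g :: "'a::metric_space \<Rightarrow> real"
  assumes "0 < \<theta>" "\<And>x y. x \<in> S \<Longrightarrow> y \<in> S \<Longrightarrow> \<bar>g x - g y\<bar> \<le> L * dist x y powr \<theta>"
  shows "continuous_on S g"
  unfolding continuous_on_def
proof
  fix x assume x: "x \<in> S"
  have "continuous_on S (\<lambda>y. L * dist y x powr \<theta>)"
    using assms(1) by (intro continuous_intros continuous_on_powr') auto
  then have "((\<lambda>y. L * dist y x powr \<theta>) \<longlongrightarrow> L * dist x x powr \<theta>) (at x within S)"
    using x unfolding continuous_on_def by blast
  then have lim: "((\<lambda>y. L * dist y x powr \<theta>) \<longlongrightarrow> 0) (at x within S)"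
    using assms(1) by simp
  have "((\<lambda>y. g y - g x) \<longlongrightarrow> 0) (at x within S)"
    by (rule Lim_null_comparison[OF _ lim])
      (use assms(2) x in \<open>auto simp: eventually_at intro: exI[of _ 1]\<close>)
  then show "(g \<longlongrightarrow> g x) (at x within S)" by (simp add: Lim_null[of g])
qed

lemma AE_Q: "AE x in lborel. x \<in> X \<longrightarrow> x \<in> Q"
proof -
  interpret prob_space leb_X by (rule prob_space_leb_X)
  have X1: "emeasure lborel X = 1"
    using emeasure_space_1 X_borel by (simp add: space_leb_X leb_X_def emeasure_restrict_space)
  have "Q \<subseteq> X" by (auto simp: Q_def X_def)
  then have "emeasure lborel (X - Q) = 0"
    using X1 X_borel by (subst emeasure_Diff) (auto simp: emeasure_Q)
  then have "X - Q \<in> null_sets lborel" using X_borel by auto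
  then show ?thesis by (rule AE_I') auto
qed

text \<open>The Hoelder version \<open>g\<close> is continuous on the compact square, hence bounded
  and Borel after extension by 0. Passing from \<open>X\<close> to \<open>Q\<close> drops only a
  null set.\<close>

lemma holder_density:
  assumes \<mu>: "prob_space \<mu>" "sets \<mu> = sets leb_X" "absolutely_continuous leb_X \<mu>"
    and g: "AE x in leb_X. enn2real (RN_deriv leb_X \<mu> x) = g x"
      "holder_seminorm \<theta> g \<le> ereal L" and \<theta>: "0 < \<theta>"
  obtains h B where "h \<in> borel_measurable borel" "\<And>x. \<bar>h x\<bar> \<le> B"
    "\<And>x y. x \<in> Q \<Longrightarrow> y \<in> Q \<Longrightarrow> \<bar>h x - h y\<bar> \<le> L * dist x y powr \<theta>"
    "\<And>S. S \<in> sets leb_X \<Longrightarrow> measure \<mu> S = (\<integral>x. indicator Q x * (indicator S x * h x) \<partial>lborel)"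
proof -
  interpret \<mu>: prob_space \<mu> by fact
  interpret m: prob_space leb_X by (rule prob_space_leb_X)
  define h where "h x = indicator X x * g x" for x
  have cont: "continuous_on X g"
    using \<theta> holder_seminormD[OF g(2)] by (rule holder_continuous_on)
  have gX: "g \<in> borel_measurable leb_X"
    unfolding leb_X_def using borel_measurable_continuous_on_restrict[OF cont]
    by (simp add: measurable_def space_restrict_space sets_restrict_space)
  have h: "h \<in> borel_measurable borel"
    using borel_measurable_continuous_on_indicator[OF X_borel cont] by (simp add: h_def[abs_def])
  have "compact X" unfolding X_def by (intro compact_Times) auto
  then have "bounded (g ` X)" using cont compact_continuous_image compact_imp_bounded by blast
  then obtain B where "B > 0" "\<forall>y\<in>g ` X. norm y \<le> B" unfolding bounded_pos by blast
  then have bnd: "\<bar>h x\<bar> \<le> B" for x by (auto simp: h_def indicator_def)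
  have "Q \<subseteq> X" by (auto simp: Q_def X_def)
  then have hold: "\<bar>h x - h y\<bar> \<le> L * dist x y powr \<theta>" if "x \<in> Q" "y \<in> Q" for x y
    using holder_seminormD[OF g(2)] that by (auto simp: h_def subset_eq)
  obtain D where D: "D \<in> borel_measurable leb_X" "AE x in leb_X. RN_deriv leb_X \<mu> x = ennreal (D x)"
    "\<And>x. 0 \<le> D x"
    using m.real_RN_deriv[OF \<mu>.finite_measure_axioms \<mu>(3,2)] by metis
  \<comment> \<open>\<open>enn2real\<close> recovers \<open>D x\<close> since \<open>D\<close> is
    nonnegative; its default value 0 at infinity does not occur on this set of full measure.\<close>
  have Dg: "AE x in leb_X. D x = g x" using g(1) D(2) by eventually_elim (use D(3) in simp)
  have dens: "\<mu> = density leb_X (\<lambda>x. ennreal (D x))"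
    using m.density_RN_deriv[OF \<mu>(3,2)] D(1,2) by (subst density_cong[symmetric]) auto
  have meas: "measure \<mu> S = (\<integral>x. indicator Q x * (indicator S x * h x) \<partial>lborel)" if S: "S \<in> sets leb_X" for S
  proof -
    note [measurable] = h
    have Sb [measurable]: "S \<in> sets borel" and SX: "S \<subseteq> X"
      using S X_borel by (auto simp: leb_X_def sets_restrict_space_iff)
    have "measure \<mu> S = (\<integral>x. indicator S x \<partial>\<mu>)"
      using S sets.sets_into_space[OF S] sets_eq_imp_space_eq[OF \<mu>(2)] by (simp add: Int_absorb2)
    also have "\<dots> = (\<integral>x. D x * indicator S x \<partial>leb_X)"
      unfolding dens using D S by (subst integral_density) auto
    also have "\<dots> = (\<integral>x. g x * indicator S x \<partial>leb_X)"
      using D(1) gX S by (intro integral_cong_AE) (use Dg in \<open>auto\<close>)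
    also have "\<dots> = (\<integral>x. indicator X x * (g x * indicator S x) \<partial>lborel)"
      unfolding leb_X_def using X_borel by (subst integral_restrict_space) auto
    also have "\<dots> = (\<integral>x. indicator S x * h x \<partial>lborel)"
      by (simp add: h_def ac_simps)
    also have "\<dots> = (\<integral>x. indicator Q x * (indicator S x * h x) \<partial>lborel)"
    proof (rule integral_cong_AE)
      show "AE x in lborel. indicator S x * h x = indicator Q x * (indicator S x * h x)"
        using AE_Q by eventually_elim (use SX in \<open>auto simp: indicator_def\<close>)
    qed auto
    finally show ?thesis .
  qed
  show thesis by (rule that[OF h bnd hold meas])
qed

text \<open>A bound by a multiple of a probability measure adds up, over any finite partition, to
  the multiple itself.\<close>

lemma total_variation_le:
  assumes "prob_space N" "0 \<le> C" "\<And>A. A \<in> sets N \<Longrightarrow> \<bar>\<nu> A\<bar> \<le> C * measure N A"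
  shows "total_variation N \<nu> \<le> ereal C"
  unfolding total_variation_def
proof (rule SUP_least)
  interpret prob_space N by fact
  fix P assume "P \<in> {P. finite P \<and> partition_on (space N) P \<and> P \<subseteq> sets N}"
  then have P: "finite P" "partition_on (space N) P" "P \<subseteq> sets N" by auto
  have "(\<Sum>A\<in>P. \<bar>\<nu> A\<bar>) \<le> (\<Sum>A\<in>P. C * measure N A)"
    using P assms(3) by (intro sum_mono) auto
  also have "\<dots> = C * (\<Sum>A\<in>P. measure N A)" by (simp add: sum_distrib_left)
  also have "(\<Sum>A\<in>P. measure N A) = measure N (\<Union>A\<in>P. A)"
    using P by (intro finite_measure_finite_Union[symmetric])
      (auto simp: partition_on_def disjoint_family_on_def disjoint_def)
  also have "(\<Union>A\<in>P. A) = space N" using P(2) by (simp add: partition_on_def)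
  finally show "ereal (\<Sum>A\<in>P. \<bar>\<nu> A\<bar>) \<le> ereal C" by (simp add: prob_space)
qed

text \<open>Over the reals, \<open>INF\<close> and \<open>SUP\<close> are genuine bounds once the
  range is bounded, which the interval supplies.\<close>

lemma a_bounds:
  assumes "\<forall>k\<ge>1. a k \<in> {0<..<b}" "k \<ge> 1"
  shows "a_inf a \<le> a k" "a k \<le> a_sup a"
proof -
  have "bdd_below (a ` {1..})" "bdd_above (a ` {1..})"
    using assms(1) by (auto intro!: bdd_belowI[of _ 0] bdd_aboveI[of _ b] simp: less_imp_le)
  then show "a_inf a \<le> a k" "a k \<le> a_sup a"
    unfolding a_inf_def a_sup_def using assms(2) by (auto intro: cINF_lower cSUP_upper)
qed

section \<open>Choice of the constants and conclusion\<close>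

theorem theorem1p1:
  fixes M :: nat and \<theta> a_low a_upp :: real
  assumes "M \<ge> 2" and "0 < \<theta>" "\<theta> \<le> 1"
  shows "\<exists>C'>0. \<forall>L\<ge>0. \<exists>C\<^sub>L::real.
    \<forall>(a :: nat \<Rightarrow> real) (\<mu>\<^sub>1 :: (real \<times> real) measure) (\<mu>\<^sub>2 :: (real \<times> real) measure).
      (\<forall>k\<ge>1. a k \<in> {0 <..< 1 / (2 * M)}) \<longrightarrow> admissible M a \<longrightarrow>
      a_inf a = a_low \<longrightarrow> a_sup a = a_upp \<longrightarrow>
      (\<forall>\<mu> \<in> {\<mu>\<^sub>1, \<mu>\<^sub>2}. prob_space \<mu> \<and> sets \<mu> = sets leb_X \<and>
          absolutely_continuous leb_X \<mu> \<and>
          (\<exists>g. (AE x in leb_X. enn2real (RN_deriv leb_X \<mu> x) = g x) \<and>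
               holder_seminorm \<theta> g \<le> ereal L)) \<longrightarrow>
      (\<forall>n\<ge>1. total_variation leb_X
          (\<lambda>A. measure (distr \<mu>\<^sub>1 leb_X (baker_comp M a 1 n)) A
             - measure (distr \<mu>\<^sub>2 leb_X (baker_comp M a 1 n)) A)
        \<le> ereal (C\<^sub>L * exp (- C' * real n)))"
proof (cases "0 < a_low \<and> a_low \<le> a_upp \<and> a_upp < 1 / (2 * M)")
  case False
  \<comment> \<open>\<open>a_low\<close> and \<open>a_upp\<close> are fixed before the sequence. If
    no admissible sequence can have them, the claim is vacuous and any rate will do.\<close>
  have "\<not> (admissible M a \<and> a_inf a = a_low \<and> a_sup a = a_upp)" for a
    using False by (auto simp: admissible_def)
  then show ?thesis by (intro exI[of _ 1]) auto
next
  case True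
  define q where "q = M * a_upp"
  \<comment> \<open>The cap \<open>M powr \<theta>\<close> lets Hoelder densities enter the digit
    class; the cap \<open>1 / (2 * q)\<close> gives \<open>q * s \<le> 1 / 2\<close>, which makes
    the mean digit factor less than 1. \<open>\<eta>\<close> is the largest value the contraction
    lemma admits, and \<open>\<rho>\<close> is the larger of its two factors.\<close>
  define s where "s = min (M powr \<theta>) (1 / (2 * q))"
  define \<eta> where "\<eta> = q * (s - 1)"
  define \<rho> where "\<rho> = max (q * s + (1 - q) / s) ((1 - M * a_low) powr \<theta>)"
  have M0: "real M > 0" using assms by simp
  have q: "0 < q" "q < 1 / 2" using True M0 by (auto simp: q_def field_simps)
  have "1 < M powr \<theta>" using assms by (intro gr_one_powr) auto
  then have s: "1 < s" "s \<le> M powr \<theta>" using q by (auto simp: s_def)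
  have "s \<le> 1 / (2 * q)" by (simp add: s_def)
  then have qs: "q * s \<le> 1 / 2" using q by (simp add: field_simps)
  have \<eta>: "0 < \<eta>" "\<eta> \<le> 1" using q s qs by (auto simp: \<eta>_def algebra_simps)
  \<comment> \<open>\<open>s (1 - (q s + (1 - q) / s)) = (s - 1) (1 - q - q s)\<close>\<close>
  have "0 < (s - 1) * (1 - q - q * s)" using q s qs by (intro mult_pos_pos) auto
  then have "q * s + (1 - q) / s < 1" using s by (simp add: field_simps)
  moreover
  have Mlow: "M * a_low \<le> q" "0 < M * a_low" using True M0 by (simp_all add: q_def)
  have "(1 - M * a_low) powr \<theta> < 1 powr \<theta>"
    using Mlow q assms by (intro powr_less_mono2) auto
  ultimately have \<rho>1: "\<rho> < 1" by (simp add: \<rho>_def)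
  have "0 < q * s + (1 - q) / s" using q s by (intro add_pos_pos mult_pos_pos divide_pos_pos) auto
  then have \<rho>0: "0 < \<rho>" by (simp add: \<rho>_def)
  show ?thesis
  \<comment> \<open>With this rate, \<open>exp (- C' * n)\<close> is
    \<open>\<rho> ^ n\<close>.\<close>
  proof (rule exI[of _ "- ln \<rho>"], intro conjI allI impI)
    show "- ln \<rho> > 0" using \<rho>0 \<rho>1 by simp
  next
    fix L :: real assume L: "L \<ge> 0"
    define K where "K = 2 * L / \<eta>"
    have K: "0 \<le> K" using L \<eta> by (simp add: K_def)
    show "\<exists>C\<^sub>L::real.
    \<forall>(a :: nat \<Rightarrow> real) (\<mu>\<^sub>1 :: (real \<times> real) measure) (\<mu>\<^sub>2 :: (real \<times> real) measure).
      (\<forall>k\<ge>1. a k \<in> {0 <..< 1 / (2 * M)}) \<longrightarrow> admissible M a \<longrightarrow>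
      a_inf a = a_low \<longrightarrow> a_sup a = a_upp \<longrightarrow>
      (\<forall>\<mu> \<in> {\<mu>\<^sub>1, \<mu>\<^sub>2}. prob_space \<mu> \<and> sets \<mu> = sets leb_X \<and>
          absolutely_continuous leb_X \<mu> \<and>
          (\<exists>g. (AE x in leb_X. enn2real (RN_deriv leb_X \<mu> x) = g x) \<and>
               holder_seminorm \<theta> g \<le> ereal L)) \<longrightarrow>
      (\<forall>n\<ge>1. total_variation leb_X
          (\<lambda>A. measure (distr \<mu>\<^sub>1 leb_X (baker_comp M a 1 n)) A
             - measure (distr \<mu>\<^sub>2 leb_X (baker_comp M a 1 n)) A)
        \<le> ereal (C\<^sub>L * exp (- (- ln \<rho>) * real n)))"
    \<comment> \<open>Oscillation is at most twice the digit constant, and there are two measures to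
      compare with Lebesgue measure: hence \<open>4 * K\<close>.\<close>
    proof (rule exI[of _ "4 * K"], intro allI impI)
      fix a :: "nat \<Rightarrow> real" and \<mu>\<^sub>1 \<mu>\<^sub>2 :: "(real \<times> real) measure" and n :: nat
      assume a: "\<forall>k\<ge>1. a k \<in> {0 <..< 1 / (2 * M)}" and inf: "a_inf a = a_low" and sup: "a_sup a = a_upp"
        and \<mu>: "\<forall>\<mu> \<in> {\<mu>\<^sub>1, \<mu>\<^sub>2}. prob_space \<mu> \<and> sets \<mu> = sets leb_X \<and>
          absolutely_continuous leb_X \<mu> \<and>
          (\<exists>g. (AE x in leb_X. enn2real (RN_deriv leb_X \<mu> x) = g x) \<and>
               holder_seminorm \<theta> g \<le> ereal L)"
      interpret m: prob_space leb_X by (rule prob_space_leb_X)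
      have M1: "M \<ge> 1" using assms by simp
      have low: "a_low \<le> a k" and upp: "M * a k \<le> q" if "k \<ge> 1" for k
        using a_bounds[OF a that] inf sup M0 by (auto simp: q_def)
      have a0: "0 < a k" and a1: "M * a k < 1" if "k \<ge> 1" for k
        using a that upp[OF that] q by auto
      define \<epsilon> where "\<epsilon> = 2 * (\<rho> ^ n * K)"
      \<comment> \<open>Each pushforward is compared with Lebesgue measure on \<open>Q\<close>; the
        difference of the two then follows from the triangle inequality.\<close>
      have close: "\<bar>measure (distr \<mu> leb_X (baker_comp M a 1 n)) A - measure lborel (Q \<inter> A)\<bar>
          \<le> \<epsilon> * measure lborel (Q \<inter> A)" if \<mu>': "\<mu> \<in> {\<mu>\<^sub>1, \<mu>\<^sub>2}" and A: "A \<in> sets leb_X" for \<mu> A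
      proof -
        have pr: "prob_space \<mu>" and sets: "sets \<mu> = sets leb_X"
          and ac: "absolutely_continuous leb_X \<mu>" using \<mu> \<mu>' by auto
        obtain g where g: "AE x in leb_X. enn2real (RN_deriv leb_X \<mu> x) = g x"
          "holder_seminorm \<theta> g \<le> ereal L" using \<mu> \<mu>' by blast
        obtain h B where h: "h \<in> borel_measurable borel" "\<And>x. \<bar>h x\<bar> \<le> B"
          "\<And>x y. x \<in> Q \<Longrightarrow> y \<in> Q \<Longrightarrow> \<bar>h x - h y\<bar> \<le> L * dist x y powr \<theta>"
          and meas: "\<And>S. S \<in> sets leb_X \<Longrightarrow>
            measure \<mu> S = (\<integral>x. indicator Q x * (indicator S x * h x) \<partial>lborel)"
          by (rule holder_density[OF pr sets ac g assms(2)]) blast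
        have QX: "Q \<subseteq> X" by (auto simp: Q_def X_def)
        have sp: "space \<mu> = X" using sets_eq_imp_space_eq[OF sets] by (simp add: space_leb_X)
        have "measure \<mu> X = 1" using prob_space.prob_space[OF pr] sp by simp
        moreover have "X \<in> sets leb_X" using sets.top[of leb_X] by (simp add: space_leb_X)
        moreover have "indicator Q x * (indicator X x * h x) = indicator Q x * h x" for x
          using QX by (auto simp: indicator_def)
        ultimately have int: "(\<integral>x. indicator Q x * h x \<partial>lborel) = 1"
          using meas[of X] by simp
        have "digit_holder M s \<eta> \<theta> K h"
          unfolding K_def using M1 assms s \<eta> L h(3) by (intro holder_imp_digit_holder) auto
        then have dh: "digit_holder M s \<eta> \<theta> (\<rho> ^ n * K) (transfer_iter M a n h)"
          using True q s \<eta> K \<rho>0 assms low upp a0 a1 M1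
          by (intro transfer_iter_digit_holder[of M a a_low q]) (auto simp: \<eta>_def \<rho>_def)
        have osc: "\<bar>transfer_iter M a n h x - transfer_iter M a n h y\<bar> \<le> \<epsilon>" if "x \<in> Q" "y \<in> Q" for x y
          unfolding \<epsilon>_def using digit_holder_osc[OF dh] K \<rho>0 \<eta> assms that by auto
        define S where "S = baker_comp M a 1 n -` A \<inter> X"
        have T: "baker_comp M a 1 n \<in> leb_X \<rightarrow>\<^sub>M leb_X"
          using measurable_baker_comp[of M a n] M1 a0 a1 by blast
        have S: "S \<in> sets leb_X" using measurable_sets[OF T A] by (simp add: S_def space_leb_X)
        have "measure (distr \<mu> leb_X (baker_comp M a 1 n)) A = measure \<mu> S"
          using T A sets by (subst measure_distr) (auto simp: S_def sp cong: measurable_cong_sets)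
        also have "\<dots> = (\<integral>x. indicator Q x * (indicator S x * h x) \<partial>lborel)" by (rule meas[OF S])
        also have "\<dots> = (\<integral>x. indicator Q x * (indicator A (baker_comp M a 1 n x) * h x) \<partial>lborel)"
          using QX by (intro Bochner_Integration.integral_cong refl) (auto simp: indicator_def S_def)
        finally have eq: "measure (distr \<mu> leb_X (baker_comp M a 1 n)) A = \<dots>" .
        have "A \<in> sets borel" using A X_borel by (auto simp: leb_X_def sets_restrict_space_iff)
        then show ?thesis
          unfolding eq using pushforward_close_to_lebesgue[of M a h B n \<epsilon> A] M1 a0 a1 h int osc by blast
      qed
      have "total_variation leb_X
          (\<lambda>A. measure (distr \<mu>\<^sub>1 leb_X (baker_comp M a 1 n)) A
             - measure (distr \<mu>\<^sub>2 leb_X (baker_comp M a 1 n)) A) \<le> ereal (2 * \<epsilon>)"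
      proof (rule total_variation_le[OF prob_space_leb_X])
        show \<epsilon>0: "0 \<le> 2 * \<epsilon>" using \<rho>0 K by (simp add: \<epsilon>_def)
        fix A assume A: "A \<in> sets leb_X"
        have AX: "A \<subseteq> X" using sets.sets_into_space[OF A] by (simp add: space_leb_X)
        have QA: "Q \<inter> A \<in> sets leb_X"
          using A X_borel by (auto simp: leb_X_def sets_restrict_space_iff)
        have "measure lborel (Q \<inter> A) = measure leb_X (Q \<inter> A)"
          unfolding leb_X_def using X_borel AX by (subst measure_restrict_space) auto
        also have "\<dots> \<le> measure leb_X A" using A QA by (intro m.finite_measure_mono) auto
        finally have "2 * \<epsilon> * measure lborel (Q \<inter> A) \<le> 2 * \<epsilon> * measure leb_X A"
          using \<epsilon>0 by (rule mult_left_mono)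
        then show "\<bar>measure (distr \<mu>\<^sub>1 leb_X (baker_comp M a 1 n)) A
             - measure (distr \<mu>\<^sub>2 leb_X (baker_comp M a 1 n)) A\<bar> \<le> 2 * \<epsilon> * measure leb_X A"
          using close[OF _ A, of \<mu>\<^sub>1] close[OF _ A, of \<mu>\<^sub>2] by (simp del: One_nat_def)
      qed
      also have "2 * \<epsilon> = 4 * K * exp (- (- ln \<rho>) * real n)"
        using \<rho>0 exp_of_nat2_mult[of "ln \<rho>" n] by (simp add: \<epsilon>_def)
      finally show "total_variation leb_X
          (\<lambda>A. measure (distr \<mu>\<^sub>1 leb_X (baker_comp M a 1 n)) A
             - measure (distr \<mu>\<^sub>2 leb_X (baker_comp M a 1 n)) A)
        \<le> ereal (4 * K * exp (- (- ln \<rho>) * real n))" .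
    qed
  qed
qed

end
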